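(* Assume that the hypotheses (H1), (H2), (H3) listed in the context hold, with constants $C_1,C_3,C_2$ respectively. Set $$k_0:=\frac{e^{\tau\omega}-1}{M'^2\,C_1\,C_4\,e^{2\omega\tau}},\qquad M'=\max\{M,1\},\qquad C_4=\max\Big\{C_2,\frac{C_3}{M'C_1}\Big\}.$$ Then for any $k\in\mathbb R$ with $|k|<k_0$ there exist $\omega'>0$ and $M''>0$ such that, for all $U_0\in\mathcal H$ and $f\in L^2(0,\tau;\mathcal U)$, the (mild) solution $U\in C([0,+\infty),\mathcal H)$ of $$U_t(t)=\mathcal A U(t)+k\,\mathcal C\mathcal C^*U(t-\tau)\ \text{ in }(0,+\infty),\qquad U(0)=U_0,\qquad \mathcal C^*U(t-\tau)=f(t)\ \ \forall t\in(0,\tau)$$ satisfies $$\|U(t)\|_{\mathcal H}\le M''e^{-\omega' t}\Big(\|U_0\|_{\mathcal H}+|k|\,M'C_1e^{2\omega\tau}\|f\|_{L^2(0,\tau;\mathcal U)}\Big),\qquad\forall t>0 .$$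
   Context: $\mathcal H$ is a Hilbert space; $\mathcal A$ generates a $C_0$-semigroup $(S(t))_{t\ge0}$ on $\mathcal H$ with $\|S(t)\|_{\mathcal L(\mathcal H)}\le Me^{-\omega t}$ for all $t\ge0$ ($M,\omega>0$ fixed). $\tau>0$ is a fixed delay. $\mathcal U$ is a complex Hilbert space identified with its dual. $\mathcal H_{-1}=D(\mathcal A^* )'$ is the dual of $D(\mathcal A^* )$ with respect to the pivot space $\mathcal H$; $S(t)$ extends to a $C_0$-semigroup on $\mathcal H_{-1}$, denoted by the same symbol. $\mathcal C\in\mathcal L(\mathcal U,\mathcal H_{-1})$ and $\mathcal C^*\in\mathcal L(D(\mathcal A),\mathcal U)$; precisely, $\mathcal C^*$ is a linear operator into $\mathcal U$ whose domain is a subspace of $\mathcal H$ containing $D(\mathcal A)$ and $D(\mathcal A^* )$, bounded on each of these for the graph norm, with $\langle\mathcal C u,z\rangle=\langle u,\mathcal C^*z\rangle_{\mathcal U}$ for $u\in\mathcal U$, $z\in D(\mathcal A^* )$. For $t\ge0$ and $v\in L^2(0,\tau;\mathcal U)$ (used for $t\in[0,\tau]$), $$\Phi_tv=\int_0^tS(t-\sigma)\,\mathcal C v(\sigma)\,d\sigma\in\mathcal H_{-1}.$$ Hypotheses: (H1) for all $v\in L^2(0,\tau;\mathcal U)$, $t\mapsto\Phi_tv$ belongs to $C([0,\tau],\mathcal H)$, and there is $C_1>0$ with $\|\Phi_\tau v\|_{\mathcal H}\le C_1\|v\|_{L^2(0,\tau;\mathcal U)}$ for all $v$; (H2) for all $v\in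 L^2(0,\tau;\mathcal U)$, $t\mapsto\mathcal C^*\Phi_tv$ belongs to $L^2(0,\tau;\mathcal U)$, and there is $C_3>0$ with $\|\mathcal C^*\Phi_{\cdot}v\|_{L^2(0,\tau;\mathcal U)}\le C_3\|v\|_{L^2(0,\tau;\mathcal U)}$ for all $v$; (H3) for all $z_0\in\mathcal H$, $t\mapsto\mathcal C^*S(t)z_0$ belongs to $L^2(0,\tau;\mathcal U)$, and there is $C_2>0$ with $\|\mathcal C^*S(\cdot)z_0\|_{L^2(0,\tau;\mathcal U)}\le C_2\|z_0\|_{\mathcal H}$ for all $z_0$. (In (H2), (H3) it is understood that the argument of $\mathcal C^*$ lies in its domain for a.e. $t$.) A mild solution is $U\in C([0,+\infty),\mathcal H)$ such that $\mathcal C^*U$ is defined a.e. and lies in $L^2_{loc}([0,+\infty);\mathcal U)$, and $$U(t)=S(t)U_0+k\int_0^tS(t-s)\,\mathcal C v(s)\,ds,\quad t\ge0,$$ with $v(s)=f(s)$ for $s\in(0,\tau)$ and $v(s)=\mathcal C^*U(s-\tau)$ for $s>\tau$; under (H1)–(H3) it exists and is unique. *)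

theory Defs
  imports "HOL-Analysis.Analysis"
begin

section \<open>Complex Banach and Hilbert spaces\<close>

class complex_banach = banach +
  fixes scaleC :: "complex \<Rightarrow> 'a \<Rightarrow> 'a"  (infixr \<open>*\<^sub>C\<close> 75)
  assumes scaleC_add_right: "a *\<^sub>C (x + y) = a *\<^sub>C x + a *\<^sub>C y"
    and scaleC_add_left: "(a + b) *\<^sub>C x = a *\<^sub>C x + b *\<^sub>C x"
    and scaleC_scaleC: "a *\<^sub>C (b *\<^sub>C x) = (a * b) *\<^sub>C x"
    and scaleC_of_real: "complex_of_real r *\<^sub>C x = r *\<^sub>R x"
    and norm_scaleC: "norm (a *\<^sub>C x) = cmod a * norm x"

text \<open>The inner product is linear in its first argument.\<close>

class complex_hilbert = complex_banach +
  fixes cinner :: "'a \<Rightarrow> 'a \<Rightarrow> complex"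
  assumes cinner_commute: "cinner x y = cnj (cinner y x)"
    and cinner_add_left: "cinner (x + y) z = cinner x z + cinner y z"
    and cinner_scaleC_left: "cinner (a *\<^sub>C x) y = a * cinner x y"
    and cinner_self: "cinner x x = complex_of_real ((norm x)\<^sup>2)"

instantiation complex :: complex_hilbert
begin

definition scaleC_complex :: "complex \<Rightarrow> complex \<Rightarrow> complex" where
  "scaleC_complex = (*)"

definition cinner_complex :: "complex \<Rightarrow> complex \<Rightarrow> complex" where
  "cinner_complex x y = x * cnj y"

instance
  by standard
    (simp_all add: scaleC_complex_def cinner_complex_def algebra_simps scaleR_conv_of_real
      norm_mult flip: complex_norm_square)

end

definition bounded_clinear :: "('a::complex_banach \<Rightarrow> 'b::complex_banach) \<Rightarrow> bool" where
  "bounded_clinear f \<longleftrightarrow> bounded_linear f \<and> (\<forall>c x. f (c *\<^sub>C x) = c *\<^sub>C f x)"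

definition csubspace :: "'a::complex_banach set \<Rightarrow> bool" where
  "csubspace D \<longleftrightarrow> 0 \<in> D \<and> (\<forall>x\<in>D. \<forall>y\<in>D. x + y \<in> D) \<and> (\<forall>c. \<forall>x\<in>D. c *\<^sub>C x \<in> D)"

definition clinear_on :: "'a::complex_banach set \<Rightarrow> ('a \<Rightarrow> 'b::complex_banach) \<Rightarrow> bool" where
  "clinear_on D T \<longleftrightarrow> (\<forall>x\<in>D. \<forall>y\<in>D. T (x + y) = T x + T y) \<and>
     (\<forall>c. \<forall>x\<in>D. T (c *\<^sub>C x) = c *\<^sub>C T x)"


section \<open>Semigroups, generators, adjoints\<close>

text \<open>An unbounded operator is given by its domain together with a total function whose values
  off the domain are irrelevant. Only the values of a semigroup at times \<open>t \<ge> 0\<close> matter.\<close>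

definition C0_semigroup :: "(real \<Rightarrow> 'a::complex_banach \<Rightarrow> 'a) \<Rightarrow> bool" where
  "C0_semigroup S \<longleftrightarrow>
     (\<forall>t\<ge>0. bounded_clinear (S t)) \<and>
     S 0 = id \<and>
     (\<forall>s\<ge>0. \<forall>t\<ge>0. S (s + t) = S s \<circ> S t) \<and>
     (\<forall>x. ((\<lambda>t. S t x) \<longlongrightarrow> x) (at_right 0))"

definition generates :: "'a::complex_banach set \<Rightarrow> ('a \<Rightarrow> 'a) \<Rightarrow> (real \<Rightarrow> 'a \<Rightarrow> 'a) \<Rightarrow> bool" where
  "generates D A S \<longleftrightarrow> C0_semigroup S \<and>
     D = {x. \<exists>y. ((\<lambda>t. (1 / t) *\<^sub>R (S t x - x)) \<longlongrightarrow> y) (at_right 0)} \<and>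
     (\<forall>x\<in>D. ((\<lambda>t. (1 / t) *\<^sub>R (S t x - x)) \<longlongrightarrow> A x) (at_right 0))"

definition adj_dom :: "'h::complex_hilbert set \<Rightarrow> ('h \<Rightarrow> 'h) \<Rightarrow> 'h set" where
  "adj_dom D A = {z. \<exists>w. \<forall>x\<in>D. cinner (A x) z = cinner x w}"

definition adj :: "'h::complex_hilbert set \<Rightarrow> ('h \<Rightarrow> 'h) \<Rightarrow> 'h \<Rightarrow> 'h" where
  "adj D A z = (THE w. \<forall>x\<in>D. cinner (A x) z = cinner x w)"

definition graph_norm :: "('h::complex_hilbert \<Rightarrow> 'h) \<Rightarrow> 'h \<Rightarrow> real" where
  "graph_norm T x = sqrt ((norm x)\<^sup>2 + (norm (T x))\<^sup>2)"

definition graph_bounded ::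
    "'h::complex_hilbert set \<Rightarrow> ('h \<Rightarrow> 'h) \<Rightarrow> ('h \<Rightarrow> 'b::real_normed_vector) \<Rightarrow> bool" where
  "graph_bounded D T F \<longleftrightarrow> (\<exists>K. \<forall>x\<in>D. norm (F x) \<le> K * graph_norm T x)"


section \<open>The extrapolation space\<close>

text \<open>Bounded conjugate-linear functionals on \<open>D\<close> with the graph norm of \<open>T\<close>. They are taken
  conjugate-linear so that the embedding of the pivot space, \<open>h \<mapsto> \<langle>h, \<cdot>\<rangle>\<close>, is linear.\<close>

definition graph_dual :: "'h::complex_hilbert set \<Rightarrow> ('h \<Rightarrow> 'h) \<Rightarrow> ('h \<Rightarrow> complex) set" where
  "graph_dual D T = {\<phi>. (\<forall>x\<in>D. \<forall>y\<in>D. \<phi> (x + y) = \<phi> x + \<phi> y) \<and>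
     (\<forall>c. \<forall>x\<in>D. \<phi> (c *\<^sub>C x) = cnj c * \<phi> x) \<and> graph_bounded D T \<phi>}"

definition graph_dual_norm :: "'h::complex_hilbert set \<Rightarrow> ('h \<Rightarrow> 'h) \<Rightarrow> ('h \<Rightarrow> complex) \<Rightarrow> real" where
  "graph_dual_norm D T \<phi> = (SUP z \<in> {z \<in> D. graph_norm T z \<le> 1}. cmod (\<phi> z))"

text \<open>The space \<open>D(A\<^sup>*)'\<close> depends on the operator, so it cannot itself be a type. The predicate
  says that the Banach space \<open>'e\<close> is this space: \<open>pair\<close>, the duality bracket of \<open>'e\<close> with
  \<open>D(A\<^sup>*)\<close>, is a linear isometry of \<open>'e\<close> onto the dual, and \<open>emb\<close> is the inclusion of the
  pivot space. Such an \<open>'e\<close> always exists.\<close>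

definition is_H_minus_1 ::
    "'h::complex_hilbert set \<Rightarrow> ('h \<Rightarrow> 'h) \<Rightarrow> ('e::complex_banach \<Rightarrow> 'h \<Rightarrow> complex) \<Rightarrow> ('h \<Rightarrow> 'e) \<Rightarrow> bool"
  where
  "is_H_minus_1 D A pair emb \<longleftrightarrow>
     (\<forall>e. pair e \<in> graph_dual (adj_dom D A) (adj D A)) \<and>
     (\<forall>\<phi> \<in> graph_dual (adj_dom D A) (adj D A). \<exists>e. \<forall>z \<in> adj_dom D A. pair e z = \<phi> z) \<and>
     (\<forall>e e'. \<forall>z \<in> adj_dom D A. pair (e + e') z = pair e z + pair e' z) \<and>
     (\<forall>c e. \<forall>z \<in> adj_dom D A. pair (c *\<^sub>C e) z = c * pair e z) \<and>
     (\<forall>e. norm e = graph_dual_norm (adj_dom D A) (adj D A) (pair e)) \<and>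
     (\<forall>h. \<forall>z \<in> adj_dom D A. pair (emb h) z = cinner h z)"

text \<open>The control operator \<open>C\<close> and the operator \<open>Cs\<close> (that is, \<open>C\<^sup>*\<close>) with domain \<open>DC\<close>.\<close>

definition control_pair ::
    "'h::complex_hilbert set \<Rightarrow> ('h \<Rightarrow> 'h) \<Rightarrow> ('e::complex_banach \<Rightarrow> 'h \<Rightarrow> complex) \<Rightarrow>
     ('u::complex_hilbert \<Rightarrow> 'e) \<Rightarrow> 'h set \<Rightarrow> ('h \<Rightarrow> 'u) \<Rightarrow> bool" where
  "control_pair D A pair C DC Cs \<longleftrightarrow>
     bounded_clinear C \<and>
     csubspace DC \<and> D \<subseteq> DC \<and> adj_dom D A \<subseteq> DC \<and>
     clinear_on DC Cs \<and>
     graph_bounded D A Cs \<and> graph_bounded (adj_dom D A) (adj D A) Cs \<and>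
     (\<forall>u. \<forall>z \<in> adj_dom D A. pair (C u) z = cinner u (Cs z))"


section \<open>Vector-valued integration\<close>

text \<open>The library's Bochner integral assumes a second countable target type. This is the same
  definition without that assumption, since the Hilbert spaces here need not be separable.\<close>

definition bochner_has_integral :: "'a measure \<Rightarrow> ('a \<Rightarrow> 'b::real_normed_vector) \<Rightarrow> 'b \<Rightarrow> bool" where
  "bochner_has_integral M f I \<longleftrightarrow> f \<in> borel_measurable M \<and>
     (\<exists>s. (\<forall>i. Bochner_Integration.simple_bochner_integrable M (s i)) \<and>
       (\<lambda>i. \<integral>\<^sup>+x. norm (f x - s i x) \<partial>M) \<longlonglongrightarrow> 0 \<and>
       (\<lambda>i. Bochner_Integration.simple_bochner_integral M (s i)) \<longlonglongrightarrow> I)"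

lemma bochner_has_integral_iff:
  fixes f :: "'a \<Rightarrow> 'b::{real_normed_vector, second_countable_topology}"
  shows "bochner_has_integral M f I \<longleftrightarrow> has_bochner_integral M f I"
  unfolding bochner_has_integral_def has_bochner_integral.simps by blast

definition strongly_measurable :: "'a measure \<Rightarrow> ('a \<Rightarrow> 'b::topological_space) \<Rightarrow> bool" where
  "strongly_measurable M f \<longleftrightarrow>
     (\<exists>s. (\<forall>n. simple_function M (s n)) \<and> (AE x in M. (\<lambda>n. s n x) \<longlonglongrightarrow> f x))"

text \<open>Square integrable functions on \<open>(0, T)\<close>, as functions rather than equivalence classes;
  as \<open>lebesgue_on\<close> is complete, the values on null sets play no role.\<close>

definition L2 :: "real \<Rightarrow> (real \<Rightarrow> 'b::real_normed_vector) set" where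
  "L2 T = {v. strongly_measurable (lebesgue_on {0<..<T}) v \<and>
     integrable (lebesgue_on {0<..<T}) (\<lambda>t. (norm (v t))\<^sup>2)}"

definition L2_norm :: "real \<Rightarrow> (real \<Rightarrow> 'b::real_normed_vector) \<Rightarrow> real" where
  "L2_norm T v = sqrt (LINT t|lebesgue_on {0<..<T}. (norm (v t))\<^sup>2)"


section \<open>Hypotheses and mild solutions\<close>

text \<open>\<open>Se\<close> denotes the extension of the semigroup to the extrapolation space. The predicate
  says that \<open>\<Phi>\<^sub>t v\<close>, an integral in the extrapolation space, has the value \<open>e\<close>.\<close>

definition has_Phi ::
    "(real \<Rightarrow> 'e \<Rightarrow> 'e) \<Rightarrow> ('u \<Rightarrow> 'e) \<Rightarrow> real \<Rightarrow> (real \<Rightarrow> 'u) \<Rightarrow> 'e::complex_banach \<Rightarrow> bool" where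
  "has_Phi Se C t v e \<longleftrightarrow>
     bochner_has_integral (lebesgue_on {0..t}) (\<lambda>\<sigma>. Se (t - \<sigma>) (C (v \<sigma>))) e"

definition hyp_H1 ::
    "('h::complex_hilbert \<Rightarrow> 'e::complex_banach) \<Rightarrow> (real \<Rightarrow> 'e \<Rightarrow> 'e) \<Rightarrow>
     ('u::complex_hilbert \<Rightarrow> 'e) \<Rightarrow> real \<Rightarrow> real \<Rightarrow> bool" where
  "hyp_H1 emb Se C \<tau> C1 \<longleftrightarrow> C1 > 0 \<and>
     (\<forall>v \<in> L2 \<tau>. \<exists>\<phi>. continuous_on {0..\<tau>} \<phi> \<and>
        (\<forall>t\<in>{0..\<tau>}. has_Phi Se C t v (emb (\<phi> t))) \<and>
        norm (\<phi> \<tau>) \<le> C1 * L2_norm \<tau> v)"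

text \<open>In the next definition \<open>\<phi> t\<close> is \<open>\<Phi>\<^sub>t v\<close> seen in the pivot space; it exists by the
  previous hypothesis and is unique.\<close>

definition hyp_H2 ::
    "('h::complex_hilbert \<Rightarrow> 'e::complex_banach) \<Rightarrow> (real \<Rightarrow> 'e \<Rightarrow> 'e) \<Rightarrow>
     ('u::complex_hilbert \<Rightarrow> 'e) \<Rightarrow> 'h set \<Rightarrow> ('h \<Rightarrow> 'u) \<Rightarrow> real \<Rightarrow> real \<Rightarrow> bool" where
  "hyp_H2 emb Se C DC Cs \<tau> C3 \<longleftrightarrow> C3 > 0 \<and>
     (\<forall>v \<in> L2 \<tau>. \<forall>\<phi>. (\<forall>t\<in>{0..\<tau>}. has_Phi Se C t v (emb (\<phi> t))) \<longrightarrow>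
        (AE t in lebesgue_on {0<..<\<tau>}. \<phi> t \<in> DC) \<and>
        (\<lambda>t. Cs (\<phi> t)) \<in> L2 \<tau> \<and>
        L2_norm \<tau> (\<lambda>t. Cs (\<phi> t)) \<le> C3 * L2_norm \<tau> v)"

definition hyp_H3 ::
    "(real \<Rightarrow> 'h \<Rightarrow> 'h) \<Rightarrow> 'h::complex_hilbert set \<Rightarrow> ('h \<Rightarrow> 'u::complex_hilbert) \<Rightarrow>
     real \<Rightarrow> real \<Rightarrow> bool" where
  "hyp_H3 S DC Cs \<tau> C2 \<longleftrightarrow> C2 > 0 \<and>
     (\<forall>z. (AE t in lebesgue_on {0<..<\<tau>}. S t z \<in> DC) \<and>
        (\<lambda>t. Cs (S t z)) \<in> L2 \<tau> \<and>
        L2_norm \<tau> (\<lambda>t. Cs (S t z)) \<le> C2 * norm z)"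

text \<open>The Duhamel formula is an identity in the extrapolation space, as the integral need not
  a priori lie in the pivot space.\<close>

definition mild_solution ::
    "('h::complex_hilbert \<Rightarrow> 'e::complex_banach) \<Rightarrow> (real \<Rightarrow> 'h \<Rightarrow> 'h) \<Rightarrow> (real \<Rightarrow> 'e \<Rightarrow> 'e) \<Rightarrow>
     ('u::complex_hilbert \<Rightarrow> 'e) \<Rightarrow> 'h set \<Rightarrow> ('h \<Rightarrow> 'u) \<Rightarrow> real \<Rightarrow> real \<Rightarrow> 'h \<Rightarrow> (real \<Rightarrow> 'u) \<Rightarrow>
     (real \<Rightarrow> 'h) \<Rightarrow> bool" where
  "mild_solution emb S Se C DC Cs \<tau> k U0 f U \<longleftrightarrow>
     continuous_on {0..} U \<and>
     (AE t in lebesgue_on {0..}. U t \<in> DC) \<and>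
     (\<forall>T>0. (\<lambda>t. Cs (U t)) \<in> L2 T) \<and>
     (\<forall>t\<ge>0. \<exists>e. has_Phi Se C t (\<lambda>s. if s < \<tau> then f s else Cs (U (s - \<tau>))) e \<and>
        emb (U t) = emb (S t U0) + k *\<^sub>R e)"

end

theory Submission
  imports Defs
begin

text \<open>
  Write \<open>q = exp (- \<omega> \<tau>)\<close> and cut time into intervals of length \<open>\<tau>\<close>. On the \<open>n\<close>-th interval the
  input is a known window \<open>v\<^sub>n\<close>: it is \<open>f\<close> for \<open>n = 0\<close> and the observation
  \<open>C\<^sup>* U\<close> of the preceding interval afterwards. So the delay equation is an iteration
  \<open>U(n \<tau> + s) = S(s) U(n \<tau>) + k \<Phi>\<^sub>s v\<^sub>n\<close>,
  \<open>v\<^sub>n\<^sub>+\<^sub>1 = C\<^sup>* S(\<cdot>) U(n \<tau>) + k C\<^sup>* \<Phi>\<^sub>\<cdot> v\<^sub>n\<close>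
  (lemmas \<open>restart\<close> and \<open>window_Suc\<close>), whose four blocks are bounded by the exponential
  stability and by the three hypotheses.

  The constant \<open>M\<close> may exceed \<open>1\<close>, so \<open>S(\<tau>)\<close> need not contract the given norm. It does
  contract the equivalent norm \<open>sup\<^sub>r exp (\<omega> r) \<parallel>S(r) x\<parallel>\<close>, by the factor \<open>q\<close>. With
  \<open>a\<^sub>n\<close> this norm of \<open>U(n \<tau>)\<close> and \<open>b\<^sub>n = \<bar>k\<bar> M' C\<^sub>1 \<parallel>v\<^sub>n\<parallel>\<close> one gets
  \<open>a\<^sub>n\<^sub>+\<^sub>1 \<le> q a\<^sub>n + b\<^sub>n\<close> and \<open>b\<^sub>n\<^sub>+\<^sub>1 \<le> \<kappa> (a\<^sub>n + b\<^sub>n)\<close> with the loop gain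
  \<open>\<kappa> = \<bar>k\<bar> M' C\<^sub>1 C\<^sub>4\<close>. Then \<open>a\<^sub>n + b\<^sub>n / q\<close> decreases at least by the factor \<open>q + \<kappa> / q\<close> in each
  step (lemma \<open>norm_U_geometric\<close>). This factor is below \<open>1\<close> exactly when \<open>\<kappa> < q (1 - q)\<close>,
  and \<open>\<bar>k\<bar> < k\<^sub>0\<close> means \<open>M' \<kappa> < q (1 - q)\<close>.

  The functional analysis behind the iteration is done weakly. An element of the extrapolation
  space is determined by its pairings with \<open>D(A\<^sup>*)\<close>, and each pairing turns a
  vector-valued integral into a scalar one, which can be split and translated. For
  this the pairings must be bounded, which uses that \<open>D(A)\<close> is dense (so that the adjoint and its
  graph norm are homogeneous), and the pivot space must embed injectively, which uses that
  \<open>D(A\<^sup>*)\<close> is dense (lemma \<open>adj_domain_total\<close>, by Riesz representation).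
\<close>

section \<open>Complex Hilbert spaces\<close>

lemma cinner_add_right: "cinner z (x + y) = cinner z x + cinner z y"
  by (metis cinner_commute cinner_add_left complex_cnj_add)

lemma cinner_scaleC_right: "cinner x (a *\<^sub>C y) = cnj a * cinner x y"
  by (metis cinner_commute cinner_scaleC_left complex_cnj_mult)

lemma cinner_zero_left [simp]: "cinner 0 x = 0"
  using cinner_add_left[of 0 0 x] by simp

lemma cinner_zero_right [simp]: "cinner x 0 = 0"
  using cinner_add_right[of x 0 0] by simp

lemma cinner_scaleR_left: "cinner (r *\<^sub>R x) y = complex_of_real r * cinner x y"
  by (metis cinner_scaleC_left scaleC_of_real)

lemma cinner_scaleR_right: "cinner x (r *\<^sub>R y) = complex_of_real r * cinner x y"
  by (metis cinner_scaleC_right scaleC_of_real complex_cnj_complex_of_real)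

lemma cinner_minus_left: "cinner (- x) y = - cinner x y"
  using cinner_scaleR_left[of "-1"] by simp

lemma cinner_minus_right: "cinner x (- y) = - cinner x y"
  using cinner_scaleR_right[of _ "-1"] by simp

lemma cinner_diff_left: "cinner (x - y) z = cinner x z - cinner y z"
  using cinner_add_left[of x "-y" z] by (simp add: cinner_minus_left)

lemma cinner_diff_right: "cinner z (x - y) = cinner z x - cinner z y"
  using cinner_add_right[of z x "-y"] by (simp add: cinner_minus_right)

lemma cinner_eq_zero_self: "cinner x x = 0 \<Longrightarrow> x = 0"
  by (simp add: cinner_self)

lemma norm_add_square: "(norm (x + y))\<^sup>2 = (norm x)\<^sup>2 + (norm y)\<^sup>2 + 2 * Re (cinner x (y::'a::complex_hilbert))"
proof -
  have "complex_of_real ((norm (x + y))\<^sup>2) = cinner (x + y) (x + y)"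
    by (rule cinner_self[symmetric])
  also have "\<dots> = complex_of_real ((norm x)\<^sup>2) + complex_of_real ((norm y)\<^sup>2) + (cinner x y + cnj (cinner x y))"
    using cinner_commute[of y x]
    by (simp only: cinner_add_left cinner_add_right) (simp add: cinner_self)
  finally have "Re (complex_of_real ((norm (x + y))\<^sup>2)) =
      Re (complex_of_real ((norm x)\<^sup>2) + complex_of_real ((norm y)\<^sup>2) + (cinner x y + cnj (cinner x y)))"
    by simp
  then show ?thesis by simp
qed

lemma norm_diff_square: "(norm (x - y))\<^sup>2 = (norm x)\<^sup>2 + (norm y)\<^sup>2 - 2 * Re (cinner x (y::'a::complex_hilbert))"
  using norm_add_square[of x "-y"] by (simp add: cinner_minus_right)

text \<open>Rotating \<open>x\<close> makes the inner product real and nonnegative, so the real part carries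
  the whole modulus.\<close>

lemma cmod_cinner_le: "cmod (cinner x (y::'a::complex_hilbert)) \<le> norm x * norm y"
proof -
  have re: "Re (cinner x y) \<le> norm x * norm y" for x y :: 'a
  proof (cases "x = 0 \<or> y = 0")
    case False
    then have pos: "norm x > 0" "norm y > 0" by auto
    have "0 \<le> (norm (norm y *\<^sub>R x - norm x *\<^sub>R y))\<^sup>2" by simp
    also have "\<dots> = 2 * (norm x)\<^sup>2 * (norm y)\<^sup>2 - 2 * (norm x * norm y) * Re (cinner x y)"
      by (simp add: norm_diff_square cinner_scaleR_left cinner_scaleR_right power_mult_distrib algebra_simps)
    finally have "(norm x * norm y) * Re (cinner x y) \<le> (norm x * norm y) * (norm x * norm y)"
      by (simp add: power2_eq_square algebra_simps)
    then show ?thesis using pos by (simp add: mult_le_cancel_left)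
  qed auto
  define c where "c = cnj (sgn (cinner x y))"
  have "c * cinner x y = complex_of_real (cmod (cinner x y))"
    using complex_norm_square[of "cinner x y"]
    by (cases "cinner x y = 0") (auto simp: c_def sgn_eq power2_eq_square field_simps)
  then have "cmod (cinner x y) = Re (cinner (c *\<^sub>C x) y)"
    by (simp add: cinner_scaleC_left)
  also have "\<dots> \<le> norm (c *\<^sub>C x) * norm y" by (rule re)
  also have "\<dots> \<le> norm x * norm y"
    by (intro mult_right_mono) (auto simp: norm_scaleC c_def norm_sgn mult_left_le_one_le)
  finally show ?thesis .
qed

lemma bounded_linear_cinner_left: "bounded_linear (\<lambda>x. cinner x y)"
  by (rule bounded_linear_intro[where K = "norm y"])
    (auto simp: cinner_add_left cinner_scaleR_left scaleR_conv_of_real cmod_cinner_le)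

text \<open>Riesz representation. The representing vector minimises \<open>\<parallel>x\<parallel>\<^sup>2 - 2 Re \<phi>(x)\<close>: by the
  parallelogram law every minimising sequence is Cauchy, and stationarity at the minimiser
  is the assertion.\<close>

lemma riesz_representation:
  fixes \<phi> :: "'h::complex_hilbert \<Rightarrow> complex"
  assumes "bounded_clinear \<phi>"
  obtains z where "\<And>x. \<phi> x = cinner x z"
proof -
  have bl: "bounded_linear \<phi>" and sc: "\<And>c x. \<phi> (c *\<^sub>C x) = c * \<phi> x"
    using assms by (auto simp: bounded_clinear_def scaleC_complex_def)
  interpret bounded_linear \<phi> by (rule bl)
  obtain K where K: "\<And>x. cmod (\<phi> x) \<le> norm x * K"
    using bounded by blast
  define J where "J x = (norm x)\<^sup>2 - 2 * Re (\<phi> x)" for x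
  have J_ge: "- K\<^sup>2 \<le> J x" for x
  proof -
    have "Re (\<phi> x) \<le> norm x * K"
      using complex_Re_le_cmod[of "\<phi> x"] K[of x] by linarith
    moreover have "0 \<le> (norm x - K)\<^sup>2" by simp
    ultimately show ?thesis by (simp add: J_def power2_diff)
  qed
  then have bdd: "bdd_below (range J)" by (intro bdd_belowI) auto
  define m where "m = Inf (range J)"
  have m_le: "m \<le> J x" for x
    unfolding m_def by (rule cInf_lower) (use bdd in auto)
  have "\<exists>x. J x < m + inverse (real (Suc n))" for n
    using cInf_lessD[of "range J" "m + inverse (real (Suc n))"] by (auto simp: m_def)
  then obtain x where x: "\<And>n. J (x n) < m + inverse (real (Suc n))" by metis
  have para: "(norm (a - b))\<^sup>2 = 2 * J a + 2 * J b - 4 * J ((1/2) *\<^sub>R (a + b))" for a b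
  proof -
    have "(norm ((1/2) *\<^sub>R (a + b)))\<^sup>2 = (1/4) * (norm (a + b))\<^sup>2"
      by (simp only: norm_scaleR power_mult_distrib) (simp add: power2_eq_square)
    then show ?thesis
      by (simp add: J_def norm_diff_square norm_add_square scaleR add algebra_simps)
  qed
  have "Cauchy x"
  proof (rule metric_CauchyI)
    fix e :: real assume "e > 0"
    then obtain N where N: "inverse (real (Suc N)) < e\<^sup>2 / 4"
      using reals_Archimedean[of "e\<^sup>2 / 4"] by auto
    have "dist (x i) (x j) < e" if "i \<ge> N" "j \<ge> N" for i j
    proof -
      have "J (x n) < m + e\<^sup>2 / 4" if "n \<ge> N" for n
      proof -
        have "inverse (real (Suc n)) \<le> inverse (real (Suc N))" using that by simp
        then show ?thesis using x[of n] N by linarith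
      qed
      from this[OF that(1)] this[OF that(2)] have "(norm (x i - x j))\<^sup>2 < e\<^sup>2"
        unfolding para using m_le[of "(1/2) *\<^sub>R (x i + x j)"] by linarith
      then show ?thesis
        using \<open>e > 0\<close> by (simp add: dist_norm power_less_imp_less_base)
    qed
    then show "\<exists>N. \<forall>i\<ge>N. \<forall>j\<ge>N. dist (x i) (x j) < e" by blast
  qed
  then obtain z where z: "x \<longlonglongrightarrow> z"
    by (auto simp: Cauchy_convergent_iff convergent_def)
  have "(\<lambda>n. J (x n)) \<longlonglongrightarrow> J z"
    unfolding J_def by (intro tendsto_intros tendsto z)
  moreover have "(\<lambda>n. m + inverse (real (Suc n))) \<longlonglongrightarrow> m + 0"
    by (intro tendsto_intros LIMSEQ_inverse_real_of_nat)
  ultimately have "J z \<le> m + 0"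
    by (rule LIMSEQ_le) (meson x less_imp_le)
  then have min: "J z \<le> J y" for y using m_le[of y] by simp
  have re: "Re (\<phi> y) = Re (cinner y z)" for y
  proof -
    define d where "d = Re (cinner z y) - Re (\<phi> y)"
    have q: "0 \<le> r\<^sup>2 * (norm y)\<^sup>2 + 2 * r * d" for r
    proof -
      have "J z \<le> J (z + r *\<^sub>R y)" by (rule min)
      also have "\<dots> = J z + (r\<^sup>2 * (norm y)\<^sup>2 + 2 * r * d)"
        by (simp add: J_def d_def norm_add_square add scaleR cinner_scaleR_right power_mult_distrib algebra_simps)
      finally show ?thesis by simp
    qed
    have "d = 0"
    proof (rule ccontr)
      assume "d \<noteq> 0"
      define s where "s = (norm y)\<^sup>2 + 1"
      have s: "s > 0" by (simp add: s_def add_nonneg_pos)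
      have "0 \<le> (-d/s)\<^sup>2 * (norm y)\<^sup>2 + 2 * (-d/s) * d" by (rule q)
      also have "\<dots> \<le> (-d/s)\<^sup>2 * s + 2 * (-d/s) * d"
        by (intro add_right_mono mult_left_mono) (auto simp: s_def)
      also have "\<dots> = - (d\<^sup>2 / s)" using s by (simp add: field_simps power2_eq_square)
      also have "\<dots> < 0" using s \<open>d \<noteq> 0\<close> by simp
      finally show False by simp
    qed
    then show ?thesis
      using cinner_commute[of y z] by (simp add: d_def)
  qed
  \<comment> \<open>the imaginary part of a complex linear functional is its real part at \<open>- \<i> y\<close>\<close>
  have "\<phi> y = cinner y z" for y
  proof (rule complex_eqI)
    show "Re (\<phi> y) = Re (cinner y z)" by (rule re)
    have "Re (\<phi> ((-\<i>) *\<^sub>C y)) = Re (cinner ((-\<i>) *\<^sub>C y) z)" by (rule re)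
    then show "Im (\<phi> y) = Im (cinner y z)" by (simp add: sc cinner_scaleC_left)
  qed
  then show thesis by (rule that)
qed

section \<open>Bounded semigroups and density of the domains\<close>

lemma right_average_tendsto:
  fixes g :: "real \<Rightarrow> 'b::banach"
  assumes g: "continuous_on {0..} g" and a: "a \<ge> 0"
  shows "((\<lambda>h. (1 / h) *\<^sub>R integral {a..a+h} g) \<longlongrightarrow> g a) (at_right 0)"
proof (rule tendstoI)
  fix e :: real assume e: "e > 0"
  then obtain d where d: "d > 0" "\<And>s. s \<ge> 0 \<Longrightarrow> dist s a < d \<Longrightarrow> dist (g s) (g a) < e / 2"
    using g a unfolding continuous_on_iff by (metis atLeast_iff half_gt_zero)
  have "dist ((1 / h) *\<^sub>R integral {a..a+h} g) (g a) < e" if h: "0 < h" "h < d" for h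
  proof -
    have cont: "continuous_on {a..a+h} g"
      by (rule continuous_on_subset[OF g]) (use a in auto)
    have "norm (integral {a..a+h} (\<lambda>s. g s - g a)) \<le> (e / 2) * (a + h - a)"
      by (rule integral_bound) (use h a d(2) in \<open>auto intro!: continuous_intros cont less_imp_le simp: dist_norm\<close>)
    moreover have "integral {a..a+h} (\<lambda>s. g s - g a) = integral {a..a+h} g - h *\<^sub>R g a"
      using h by (subst integral_diff) (auto intro: integrable_continuous_real cont)
    ultimately have *: "norm (integral {a..a+h} g - h *\<^sub>R g a) \<le> (e / 2) * h" by simp
    have "(1 / h) *\<^sub>R integral {a..a+h} g - g a = (1 / h) *\<^sub>R (integral {a..a+h} g - h *\<^sub>R g a)"
      using h by (simp add: scaleR_diff_right)
    then have "norm ((1 / h) *\<^sub>R integral {a..a+h} g - g a) \<le> (1 / h) * ((e / 2) * h)"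
      using mult_left_mono[OF *, of "1 / h"] h by simp
    also have "(1 / h) * ((e / 2) * h) < e" using h e by simp
    finally show ?thesis by (simp add: dist_norm)
  qed
  then show "\<forall>\<^sub>F h in at_right 0. dist ((1 / h) *\<^sub>R integral {a..a+h} g) (g a) < e"
    unfolding eventually_at_right_field using d(1) by auto
qed

text \<open>The integrals over \<open>[h, t + h]\<close> and \<open>[0, t]\<close> differ by two short boundary pieces only.
  For an orbit this puts \<open>\<integral>\<^sub>0\<^sup>t S(s) x ds\<close> into the domain of the generator, and for a scalar
  orbit \<open>\<langle>S(s) x, h\<rangle>\<close> it yields elements of the domain of the adjoint, without differentiating
  the orbit.\<close>

lemma shift_difference_tendsto:
  fixes g :: "real \<Rightarrow> 'b::banach"
  assumes g: "continuous_on {0..} g" and t: "t \<ge> 0"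
  shows "((\<lambda>h. (1 / h) *\<^sub>R (integral {0..t} (\<lambda>s. g (s + h)) - integral {0..t} g)) \<longlongrightarrow> g t - g 0)
    (at_right 0)"
proof -
  have int: "g integrable_on {a..b}" if "a \<ge> 0" for a b
    by (rule integrable_continuous_real, rule continuous_on_subset[OF g]) (use that in auto)
  have eq: "(1 / h) *\<^sub>R (integral {0..t} (\<lambda>s. g (s + h)) - integral {0..t} g) =
      (1 / h) *\<^sub>R integral {t..t+h} g - (1 / h) *\<^sub>R integral {0..0+h} g" if "h > 0" for h
  proof -
    have "(g has_integral integral {h..t+h} g) {h..t+h}"
      by (rule integrable_integral) (use that int in auto)
    from has_integral_shift_real_ivl[OF this, of h]
    have "integral {0..t} (\<lambda>s. g (s + h)) = integral {h..t+h} g"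
      by (simp add: integral_unique)
    moreover have "integral {0..h} g + integral {h..t+h} g = integral {0..t+h} g"
      by (rule Henstock_Kurzweil_Integration.integral_combine) (use that t int in auto)
    moreover have "integral {0..t} g + integral {t..t+h} g = integral {0..t+h} g"
      by (rule Henstock_Kurzweil_Integration.integral_combine) (use that t int in auto)
    ultimately have "integral {0..t} (\<lambda>s. g (s + h)) - integral {0..t} g
        = integral {t..t+h} g - integral {0..h} g"
      by (simp add: algebra_simps)
    then show ?thesis by (simp add: scaleR_diff_right)
  qed
  have lim: "((\<lambda>h. (1 / h) *\<^sub>R integral {t..t+h} g - (1 / h) *\<^sub>R integral {0..0+h} g) \<longlongrightarrow> g t - g 0) (at_right 0)"
    by (intro tendsto_diff right_average_tendsto g t) auto
  have ev: "eventually (\<lambda>h. (1 / h) *\<^sub>R integral {t..t+h} g - (1 / h) *\<^sub>R integral {0..0+h} g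
      = (1 / h) *\<^sub>R (integral {0..t} (\<lambda>s. g (s + h)) - integral {0..t} g)) (at_right (0::real))"
    using eq by (auto simp: eventually_at_right_field intro!: exI[of _ 1])
  show ?thesis by (rule Lim_transform_eventually[OF lim ev])
qed

locale bounded_semigroup =
  fixes D :: "'h::complex_hilbert set" and A :: "'h \<Rightarrow> 'h" and S :: "real \<Rightarrow> 'h \<Rightarrow> 'h" and M :: real
  assumes gen: "generates D A S"
    and bound: "\<And>t x. t \<ge> 0 \<Longrightarrow> norm (S t x) \<le> M * norm x"
begin

lemma bounded_clinear_S: "t \<ge> 0 \<Longrightarrow> bounded_clinear (S t)"
  using gen by (auto simp: generates_def C0_semigroup_def)

lemma bounded_linear_S: "t \<ge> 0 \<Longrightarrow> bounded_linear (S t)"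
  using bounded_clinear_S by (auto simp: bounded_clinear_def)

lemma S_scaleC: "t \<ge> 0 \<Longrightarrow> S t (c *\<^sub>C x) = c *\<^sub>C S t x"
  using bounded_clinear_S by (auto simp: bounded_clinear_def)

lemma S_0 [simp]: "S 0 x = x"
  using gen by (auto simp: generates_def C0_semigroup_def)

lemma S_add: "s \<ge> 0 \<Longrightarrow> t \<ge> 0 \<Longrightarrow> S (s + t) x = S s (S t x)"
  using gen by (auto simp: generates_def C0_semigroup_def)

lemma S_tendsto_0: "((\<lambda>t. S t x) \<longlongrightarrow> x) (at_right 0)"
  using gen by (auto simp: generates_def C0_semigroup_def)

lemma continuous_on_orbit: "continuous_on {0..} (\<lambda>t. S t x)"
proof -
  have M: "norm (S t y) \<le> (\<bar>M\<bar> + 1) * norm y" if "t \<ge> 0" for t y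
    using bound[OF that, of y] by (rule order_trans) (auto intro: mult_right_mono)
  have "\<exists>d>0. \<forall>s\<ge>0. dist s t < d \<longrightarrow> dist (S s x) (S t x) < e" if t: "t \<ge> 0" and e: "e > 0" for t e
  proof -
    have "\<forall>\<^sub>F r in at_right 0. dist (S r x) x < e / (\<bar>M\<bar> + 1)"
      by (rule tendstoD[OF S_tendsto_0]) (use e in auto)
    then obtain d where d: "d > 0" "\<And>r. 0 < r \<Longrightarrow> r < d \<Longrightarrow> norm (S r x - x) < e / (\<bar>M\<bar> + 1)"
      by (auto simp: eventually_at_right_field dist_norm)
    \<comment> \<open>factoring out the smaller time reduces continuity on both sides to right continuity at \<open>0\<close>\<close>
    have step: "norm (S b x - S a x) < e" if "0 \<le> a" "a \<le> b" "b - a < d" for a b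
    proof (cases "a = b")
      case False
      then have ab: "0 < b - a" using that by simp
      have "S b x - S a x = S a (S (b - a) x - x)"
        using S_add[of a "b - a" x] ab that(1) bounded_linear_S[OF that(1)]
        by (simp add: bounded_linear.linear linear_diff)
      also have "norm \<dots> \<le> (\<bar>M\<bar> + 1) * norm (S (b - a) x - x)" by (rule M[OF that(1)])
      also have "\<dots> < (\<bar>M\<bar> + 1) * (e / (\<bar>M\<bar> + 1))"
        by (rule mult_strict_left_mono) (use d(2)[OF ab] that in auto)
      finally show ?thesis by simp
    qed (use e in auto)
    have "dist (S s x) (S t x) < e" if "s \<ge> 0" "dist s t < d" for s
      using step[of s t] step[of t s] that t by (cases "s \<le> t") (auto simp: dist_norm norm_minus_commute)
    then show ?thesis using d(1) by blast
  qed
  then show ?thesis unfolding continuous_on_iff Ball_def atLeast_iff by blast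
qed

lemma continuous_on_orbit_cinner: "continuous_on {0..} (\<lambda>t. cinner (S t x) y)"
  by (rule bounded_linear.continuous_on[OF bounded_linear_cinner_left continuous_on_orbit])

lemma orbit_integral_in_domain:
  assumes t: "t \<ge> 0"
  shows "integral {0..t} (\<lambda>s. S s x) \<in> D"
proof -
  let ?y = "integral {0..t} (\<lambda>s. S s x)"
  have int: "(\<lambda>s. S s x) integrable_on {0..t}"
    by (rule integrable_continuous_real, rule continuous_on_subset[OF continuous_on_orbit]) auto
  have eq: "S h ?y = integral {0..t} (\<lambda>s. S (s + h) x)" if "h > 0" for h
  proof -
    have "S h ?y = integral {0..t} (\<lambda>s. S h (S s x))"
      using integral_linear[OF int bounded_linear_S[of h]] that by (simp add: o_def)
    also have "\<dots> = integral {0..t} (\<lambda>s. S (s + h) x)"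
      using that by (intro integral_cong) (auto simp: S_add[symmetric] add.commute)
    finally show ?thesis .
  qed
  have ev: "eventually (\<lambda>h. (1 / h) *\<^sub>R (integral {0..t} (\<lambda>s. S (s + h) x) - ?y)
      = (1 / h) *\<^sub>R (S h ?y - ?y)) (at_right (0::real))"
    using eq by (auto simp: eventually_at_right_field intro!: exI[of _ 1])
  have "((\<lambda>h. (1 / h) *\<^sub>R (S h ?y - ?y)) \<longlongrightarrow> S t x - S 0 x) (at_right 0)"
    by (rule Lim_transform_eventually[OF shift_difference_tendsto[OF continuous_on_orbit t] ev])
  then show ?thesis using gen by (auto simp: generates_def)
qed

text \<open>The averages of an orbit over \<open>[0, h]\<close> lie in \<open>D\<close> and converge to its starting point, so
  \<open>D\<close> is dense. Density is stated in the form that makes the adjoint single-valued.\<close>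

lemma domain_total:
  assumes "\<And>x. x \<in> D \<Longrightarrow> cinner x w = 0"
  shows "w = 0"
proof -
  have "((\<lambda>h. cinner ((1 / h) *\<^sub>R integral {0..0+h} (\<lambda>s. S s w)) w) \<longlongrightarrow> cinner (S 0 w) w) (at_right 0)"
    by (intro bounded_linear.tendsto[OF bounded_linear_cinner_left] right_average_tendsto continuous_on_orbit) simp
  moreover have "eventually (\<lambda>h. cinner ((1 / h) *\<^sub>R integral {0..0+h} (\<lambda>s. S s w)) w = 0) (at_right (0::real))"
    using assms orbit_integral_in_domain
    by (auto simp: eventually_at_right_field cinner_scaleR_left intro!: exI[of _ 1])
  ultimately have "((\<lambda>_. 0) \<longlongrightarrow> cinner w w) (at_right (0::real))"
    by (simp add: Lim_transform_eventually)
  then have "cinner w w = 0"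
    by (simp add: tendsto_const_iff)
  then show ?thesis by (rule cinner_eq_zero_self)
qed

lemma adj_eqI:
  assumes "\<And>x. x \<in> D \<Longrightarrow> cinner (A x) z = cinner x w"
  shows "adj D A z = w"
  unfolding adj_def
proof (rule the_equality)
  fix w' assume "\<forall>x\<in>D. cinner (A x) z = cinner x w'"
  then have "w' - w = 0"
    using assms by (intro domain_total) (auto simp: cinner_diff_right)
  then show "w' = w" by simp
qed (use assms in auto)

lemma adj_scaleR:
  assumes "z \<in> adj_dom D A"
  shows "r *\<^sub>R z \<in> adj_dom D A" "adj D A (r *\<^sub>R z) = r *\<^sub>R adj D A z"
proof -
  obtain w where w: "\<And>x. x \<in> D \<Longrightarrow> cinner (A x) z = cinner x w"
    using assms by (auto simp: adj_dom_def)
  then show "r *\<^sub>R z \<in> adj_dom D A"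
    by (auto simp: adj_dom_def cinner_scaleR_right intro!: exI[of _ "r *\<^sub>R w"])
  show "adj D A (r *\<^sub>R z) = r *\<^sub>R adj D A z"
    by (rule adj_eqI) (use w in \<open>auto simp: adj_eqI[of z w] cinner_scaleR_right\<close>)
qed

text \<open>The vectors \<open>\<integral>\<^sub>0\<^sup>t S(s)\<^sup>* h ds\<close>, formed weakly, lie in the domain of the adjoint, and
  dividing them by \<open>t\<close> approximates \<open>h\<close> weakly.\<close>

lemma adj_domain_total:
  assumes h: "\<And>z. z \<in> adj_dom D A \<Longrightarrow> cinner h z = 0"
  shows "h = 0"
proof -
  have int: "(\<lambda>s. cinner (S s x) h) integrable_on {0..t}" for t x
    by (rule integrable_continuous_real, rule continuous_on_subset[OF continuous_on_orbit_cinner]) auto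
  have zero: "integral {0..t} (\<lambda>s. cinner (S s h) h) = 0" if t: "t > 0" for t
  proof -
    define \<phi> where "\<phi> x = integral {0..t} (\<lambda>s. cinner (S s x) h)" for x
    have "bounded_clinear \<phi>"
      unfolding bounded_clinear_def
    proof (intro conjI allI)
      show \<phi>c: "\<phi> (c *\<^sub>C x) = c *\<^sub>C \<phi> x" for c x
      proof -
        have "\<phi> (c *\<^sub>C x) = integral {0..t} (\<lambda>s. c * cinner (S s x) h)"
          unfolding \<phi>_def by (intro integral_cong) (auto simp: S_scaleC cinner_scaleC_left)
        also have "\<dots> = c * \<phi> x" by (simp add: \<phi>_def)
        finally show ?thesis by (simp add: scaleC_complex_def)
      qed
      show "bounded_linear \<phi>"
      proof (rule bounded_linear_intro)
        show "\<phi> (x + y) = \<phi> x + \<phi> y" for x y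
        proof -
          have "\<phi> (x + y) = integral {0..t} (\<lambda>s. cinner (S s x) h + cinner (S s y) h)"
            unfolding \<phi>_def
            by (intro integral_cong)
              (auto simp: bounded_linear_S bounded_linear.linear linear_add cinner_add_left)
          then show ?thesis by (simp add: \<phi>_def integral_add[OF int int])
        qed
        show "\<phi> (r *\<^sub>R x) = r *\<^sub>R \<phi> x" for r x
          using \<phi>c[of "complex_of_real r" x] by (simp add: scaleC_of_real)
        show "norm (\<phi> x) \<le> norm x * (M * norm h * t)" for x
        proof -
          have "norm (\<phi> x) \<le> (M * norm x * norm h) * (t - 0)"
            unfolding \<phi>_def
          proof (rule integral_bound)
            show "continuous_on {0..t} (\<lambda>s. cinner (S s x) h)"
              by (rule continuous_on_subset[OF continuous_on_orbit_cinner]) auto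
            show "norm (cinner (S s x) h) \<le> M * norm x * norm h" if "s \<in> {0..t}" for s
              using that by (auto intro!: order_trans[OF cmod_cinner_le] mult_right_mono bound)
          qed (use t in simp)
          then show ?thesis by (simp add: algebra_simps)
        qed
      qed
    qed
    then obtain z where z: "\<And>x. \<phi> x = cinner x z"
      by (rule riesz_representation) blast
    have "bounded_clinear (\<lambda>x. cinner (S t x) h - cinner x h)"
      unfolding bounded_clinear_def
      using bounded_linear_sub[OF bounded_linear_compose[OF bounded_linear_cinner_left bounded_linear_S[of t]]
          bounded_linear_cinner_left[of h], of h] t
      by (auto simp: S_scaleC cinner_scaleC_left scaleC_complex_def algebra_simps)
    then obtain w where w: "\<And>x. cinner (S t x) h - cinner x h = cinner x w"
      by (rule riesz_representation) blast
    have "cinner (A x) z = cinner x w" if x: "x \<in> D" for x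
    proof -
      have gx: "((\<lambda>r. (1 / r) *\<^sub>R (S r x - x)) \<longlongrightarrow> A x) (at_right 0)"
        using gen x by (auto simp: generates_def)
      have l1: "((\<lambda>r. cinner ((1 / r) *\<^sub>R (S r x - x)) z) \<longlongrightarrow> cinner (A x) z) (at_right 0)"
        by (rule bounded_linear.tendsto[OF bounded_linear_cinner_left gx])
      have l2: "((\<lambda>r. (1 / r) *\<^sub>R (integral {0..t} (\<lambda>s. cinner (S (s + r) x) h)
          - integral {0..t} (\<lambda>s. cinner (S s x) h))) \<longlongrightarrow> cinner (S t x) h - cinner (S 0 x) h) (at_right 0)"
        by (rule shift_difference_tendsto[OF continuous_on_orbit_cinner]) (use t in simp)
      have eq: "(1 / r) *\<^sub>R (integral {0..t} (\<lambda>s. cinner (S (s + r) x) h)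
          - integral {0..t} (\<lambda>s. cinner (S s x) h)) = cinner ((1 / r) *\<^sub>R (S r x - x)) z" if r: "r > 0" for r
      proof -
        have "integral {0..t} (\<lambda>s. cinner (S (s + r) x) h) = \<phi> (S r x)"
          unfolding \<phi>_def using r by (intro integral_cong) (auto simp: S_add)
        moreover have "integral {0..t} (\<lambda>s. cinner (S s x) h) = \<phi> x"
          by (simp add: \<phi>_def)
        ultimately show ?thesis
          by (simp only: z cinner_scaleR_left cinner_diff_left) (simp add: scaleR_conv_of_real)
      qed
      have "((\<lambda>r. cinner ((1 / r) *\<^sub>R (S r x - x)) z) \<longlongrightarrow> cinner (S t x) h - cinner (S 0 x) h) (at_right 0)"
        by (rule Lim_transform_eventually[OF l2])
          (use eq in \<open>auto simp: eventually_at_right_field intro!: exI[of _ 1]\<close>)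
      from tendsto_unique[OF _ l1 this] show ?thesis by (simp add: w)
    qed
    then have "z \<in> adj_dom D A" by (auto simp: adj_dom_def)
    from h[OF this] show ?thesis by (simp add: z[symmetric] \<phi>_def)
  qed
  have "((\<lambda>t. (1 / t) *\<^sub>R integral {0..0+t} (\<lambda>s. cinner (S s h) h)) \<longlongrightarrow> cinner (S 0 h) h) (at_right 0)"
    by (intro right_average_tendsto continuous_on_orbit_cinner) simp
  moreover have "eventually (\<lambda>t. (1 / t) *\<^sub>R integral {0..0+t} (\<lambda>s. cinner (S s h) h) = 0) (at_right (0::real))"
    using zero by (auto simp: eventually_at_right_field intro!: exI[of _ 1])
  ultimately have "((\<lambda>_. 0) \<longlongrightarrow> cinner h h) (at_right (0::real))"
    by (simp add: Lim_transform_eventually)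
  then have "cinner h h = 0" by (simp add: tendsto_const_iff)
  then show ?thesis by (rule cinner_eq_zero_self)
qed

end

section \<open>The extrapolation space\<close>

locale extrapolation = bounded_semigroup D A S M
  for D :: "'h::complex_hilbert set" and A S M +
  fixes pair :: "'e::complex_banach \<Rightarrow> 'h \<Rightarrow> complex" and emb :: "'h \<Rightarrow> 'e"
  assumes H_minus_1: "is_H_minus_1 D A pair emb"
begin

abbreviation "D' \<equiv> adj_dom D A"
abbreviation "A' \<equiv> adj D A"

lemma pair_graph_dual: "pair e \<in> graph_dual D' A'"
  and pair_add: "z \<in> D' \<Longrightarrow> pair (e + e') z = pair e z + pair e' z"
  and pair_scaleC: "z \<in> D' \<Longrightarrow> pair (c *\<^sub>C e) z = c * pair e z"
  and norm_eq: "norm e = graph_dual_norm D' A' (pair e)"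
  and pair_emb: "z \<in> D' \<Longrightarrow> pair (emb h) z = cinner h z"
  using H_minus_1 by (auto simp: is_H_minus_1_def)

lemma pair_scaleR: "z \<in> D' \<Longrightarrow> pair (r *\<^sub>R e) z = complex_of_real r * pair e z"
  using pair_scaleC[of z "complex_of_real r" e] by (simp add: scaleC_of_real)

text \<open>The norm of \<open>e\<close> is a supremum over the unit ball of the graph norm. Dividing \<open>z\<close> by
  \<open>1 + graph_norm A' z\<close> moves it into this ball even if its graph norm is \<open>0\<close>.\<close>

lemma cmod_pair_le:
  assumes z: "z \<in> D'"
  shows "cmod (pair e z) \<le> norm e * (1 + graph_norm A' z)"
proof -
  have gn: "graph_norm A' z \<ge> 0" by (simp add: graph_norm_def)
  define r where "r = 1 / (1 + graph_norm A' z)"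
  have r: "r > 0" using gn by (simp add: r_def)
  have rz: "r *\<^sub>R z \<in> D'" by (rule adj_scaleR[OF z])
  have "graph_norm A' (r *\<^sub>R z) = sqrt (r\<^sup>2 * ((norm z)\<^sup>2 + (norm (A' z))\<^sup>2))"
    by (simp add: graph_norm_def adj_scaleR[OF z] power_mult_distrib distrib_left)
  also have "\<dots> = r * graph_norm A' z"
    using r by (simp add: graph_norm_def real_sqrt_mult)
  also have "\<dots> \<le> 1" using gn by (simp add: r_def divide_simps)
  finally have unit: "graph_norm A' (r *\<^sub>R z) \<le> 1" .
  obtain K where K: "\<And>y. y \<in> D' \<Longrightarrow> cmod (pair e y) \<le> K * graph_norm A' y"
    using pair_graph_dual[of e] unfolding graph_dual_def graph_bounded_def by blast
  have "cmod (pair e y) \<le> \<bar>K\<bar>" if "y \<in> D'" "graph_norm A' y \<le> 1" for y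
  proof -
    have "K * graph_norm A' y \<le> \<bar>K\<bar> * 1"
      using that(2) by (intro mult_mono) (auto simp: graph_norm_def)
    then show ?thesis using K[OF that(1)] by simp
  qed
  then have "bdd_above ((\<lambda>y. cmod (pair e y)) ` {y \<in> D'. graph_norm A' y \<le> 1})"
    by (intro bdd_aboveI2) auto
  then have "cmod (pair e (r *\<^sub>R z)) \<le> norm e"
    unfolding norm_eq graph_dual_norm_def by (intro cSUP_upper) (use rz unit in auto)
  moreover have "pair e (r *\<^sub>R z) = complex_of_real r * pair e z"
    using pair_graph_dual[of e] z
    by (auto simp: graph_dual_def simp flip: scaleC_of_real)
  ultimately have "r * cmod (pair e z) \<le> norm e"
    using r by (simp add: norm_mult)
  then show ?thesis
    using gn by (simp add: r_def pos_divide_le_eq add_pos_nonneg)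
qed

lemma bounded_linear_pair: "z \<in> D' \<Longrightarrow> bounded_linear (\<lambda>e. pair e z)"
  by (rule bounded_linear_intro)
    (auto simp: pair_add pair_scaleR scaleR_conv_of_real intro: cmod_pair_le)

text \<open>The norm of the extrapolation space sees only the values of the pairing on \<open>D'\<close>, so
  \<open>e - e'\<close> has the same norm as \<open>0\<close>.\<close>

lemma pair_separates:
  assumes "\<And>z. z \<in> D' \<Longrightarrow> pair e z = pair e' z"
  shows "e = e'"
proof -
  have "pair (e - e') z = pair 0 z" if "z \<in> D'" for z
  proof -
    interpret p: bounded_linear "\<lambda>e. pair e z" by (rule bounded_linear_pair[OF that])
    show ?thesis using assms[OF that] by (simp add: p.diff p.zero)
  qed
  then have "norm (e - e') = norm (0 :: 'e)"
    unfolding norm_eq graph_dual_norm_def by (intro SUP_cong) auto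
  then show ?thesis by simp
qed

text \<open>The embedding is injective because \<open>D'\<close> is dense.\<close>

lemma emb_inject: "emb x = emb y \<longleftrightarrow> x = y"
proof
  assume "emb x = emb y"
  then have "x - y = 0"
    by (intro adj_domain_total) (metis cinner_diff_left pair_emb cancel_comm_monoid_add_class.diff_cancel)
  then show "x = y" by simp
qed simp

lemma emb_add_scaleR: "emb (x + r *\<^sub>R y) = emb x + r *\<^sub>R emb y"
  by (rule pair_separates) (simp add: pair_add pair_scaleR pair_emb cinner_add_left cinner_scaleR_left)

end

section \<open>Vector-valued integrals and square integrable functions\<close>

text \<open>A bounded functional turns the Bochner integral without a countability assumption into
  the classical one.\<close>

lemma bochner_has_integral_functional:
  fixes T :: "'e::real_normed_vector \<Rightarrow> complex"
  assumes T: "bounded_linear T" and f: "bochner_has_integral M f I"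
  shows "has_bochner_integral M (\<lambda>x. T (f x)) (T I)"
proof -
  interpret T: bounded_linear T by fact
  from f obtain s where f_meas: "f \<in> borel_measurable M"
    and s: "\<And>i. Bochner_Integration.simple_bochner_integrable M (s i)"
    and lim: "(\<lambda>i. \<integral>\<^sup>+x. norm (f x - s i x) \<partial>M) \<longlonglongrightarrow> 0"
    and limI: "(\<lambda>i. Bochner_Integration.simple_bochner_integral M (s i)) \<longlonglongrightarrow> I"
    unfolding bochner_has_integral_def by blast
  have T_meas: "T \<in> borel_measurable borel"
    by (intro borel_measurable_continuous_onI T.continuous_on continuous_on_id)
  have simple: "simple_function M (s i)" for i
    using s[of i] by (auto elim: simple_bochner_integrable.cases)
  \<comment> \<open>differences of measurable maps may fail to be measurable in a nonseparable space, but
    \<open>s i\<close> takes finitely many values only\<close>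
  have diff_meas: "(\<lambda>x. norm (f x - s i x)) \<in> borel_measurable M" for i
  proof (rule measurable_compose_countable'[where g = "s i" and I = "s i ` space M"
        and f = "\<lambda>y x. norm (f x - y)"])
    show "(\<lambda>x. norm (f x - y)) \<in> borel_measurable M" for y
      by (rule measurable_compose[OF f_meas]) (intro borel_measurable_continuous_onI continuous_intros)
    show "s i \<in> measurable M (count_space (s i ` space M))"
      using simple_functionD[OF simple[of i]]
      by (auto simp: measurable_def)
    show "countable (s i ` space M)"
      using simple_functionD(1)[OF simple[of i]] by (rule countable_finite)
  qed
  obtain K where K: "K > 0" "\<And>x i. norm (T (f x) - T (s i x)) \<le> norm (f x - s i x) * K"
    using T.pos_bounded by (auto simp: T.diff[symmetric])
  show ?thesis
  proof (rule has_bochner_integral.intros[where s = "\<lambda>i x. T (s i x)"])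
    show "(\<lambda>x. T (f x)) \<in> borel_measurable M"
      by (rule measurable_compose[OF f_meas T_meas])
    show "Bochner_Integration.simple_bochner_integrable M (\<lambda>x. T (s i x))" for i
      using simple_bochner_integrable_compose2[where p = "\<lambda>x y. T x", OF _ s s] T.zero by simp
    show "(\<lambda>i. \<integral>\<^sup>+ x. norm (T (f x) - T (s i x)) \<partial>M) \<longlonglongrightarrow> 0"
    proof (rule tendsto_sandwich[where f = "\<lambda>_. 0" and h = "\<lambda>i. K * (\<integral>\<^sup>+ x. norm (f x - s i x) \<partial>M)"])
      show "eventually (\<lambda>i. (\<integral>\<^sup>+ x. norm (T (f x) - T (s i x)) \<partial>M) \<le> K * (\<integral>\<^sup>+ x. norm (f x - s i x) \<partial>M)) sequentially"
      proof (intro always_eventually allI)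
        fix i have "(\<integral>\<^sup>+ x. norm (T (f x) - T (s i x)) \<partial>M) \<le> (\<integral>\<^sup>+ x. ennreal K * norm (f x - s i x) \<partial>M)"
          using K by (intro nn_integral_mono) (auto simp: ac_simps ennreal_mult[symmetric])
        also have "\<dots> = K * (\<integral>\<^sup>+ x. norm (f x - s i x) \<partial>M)"
          using diff_meas[of i] by (intro nn_integral_cmult) auto
        finally show "(\<integral>\<^sup>+ x. norm (T (f x) - T (s i x)) \<partial>M) \<le> K * (\<integral>\<^sup>+ x. norm (f x - s i x) \<partial>M)" .
      qed
      show "(\<lambda>i. K * (\<integral>\<^sup>+ x. norm (f x - s i x) \<partial>M)) \<longlonglongrightarrow> 0"
        using ennreal_tendsto_cmult[OF _ lim, of K] by simp
    qed auto
    show "(\<lambda>i. Bochner_Integration.simple_bochner_integral M (\<lambda>x. T (s i x))) \<longlonglongrightarrow> T I"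
      by (simp add: simple_bochner_integral_linear[OF T.linear s] T.tendsto[OF limI])
  qed
qed

lemma has_Phi_functional:
  fixes T :: "'e::complex_banach \<Rightarrow> complex"
  assumes "bounded_linear T" "has_Phi Se C t v e"
  shows "((\<lambda>\<sigma>. T (Se (t - \<sigma>) (C (v \<sigma>)))) has_integral T e) {0..t}"
proof -
  have "has_bochner_integral (lebesgue_on {0..t}) (\<lambda>\<sigma>. T (Se (t - \<sigma>) (C (v \<sigma>)))) (T e)"
    using assms unfolding has_Phi_def by (rule bochner_has_integral_functional)
  then show ?thesis
    using has_integral_integral_lebesgue_on[of "{0..t}" "\<lambda>\<sigma>. T (Se (t - \<sigma>) (C (v \<sigma>)))"]
    by (auto simp: has_bochner_integral_iff)
qed

lemma borel_measurable_lebesgue_AE_LIMSEQ: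
  fixes u :: "nat \<Rightarrow> real \<Rightarrow> real"
  assumes u: "\<And>n. u n \<in> borel_measurable (lebesgue_on \<Omega>)" and \<Omega>: "\<Omega> \<in> sets lebesgue"
    and lim: "AE x in lebesgue_on \<Omega>. (\<lambda>n. u n x) \<longlonglongrightarrow> F x"
  shows "F \<in> borel_measurable (lebesgue_on \<Omega>)"
proof -
  obtain N where N: "N \<in> null_sets (lebesgue_on \<Omega>)"
    "{x \<in> space (lebesgue_on \<Omega>). \<not> (\<lambda>n. u n x) \<longlonglongrightarrow> F x} \<subseteq> N"
    using lim unfolding eventually_ae_filter by auto
  have "F \<in> borel_measurable (lebesgue_on (\<Omega> - N))"
  proof (rule borel_measurable_LIMSEQ_metric)
    show "u n \<in> borel_measurable (lebesgue_on (\<Omega> - N))" for n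
      by (rule measurable_restrict_mono[OF u]) auto
    show "(\<lambda>n. u n x) \<longlonglongrightarrow> F x" if "x \<in> space (lebesgue_on (\<Omega> - N))" for x
      using that N(2) by auto
  qed
  then show ?thesis using borel_measurable_diff_null[OF N(1) \<Omega>, of F] by simp
qed

lemma strongly_measurable_add_scaleR:
  fixes f g :: "'a \<Rightarrow> 'b::real_normed_vector"
  assumes "strongly_measurable M f" "strongly_measurable M g"
  shows "strongly_measurable M (\<lambda>x. f x + r *\<^sub>R g x)"
proof -
  obtain s t where s: "\<And>n. simple_function M (s n)" "AE x in M. (\<lambda>n. s n x) \<longlonglongrightarrow> f x"
    and t: "\<And>n. simple_function M (t n)" "AE x in M. (\<lambda>n. t n x) \<longlonglongrightarrow> g x"
    using assms unfolding strongly_measurable_def by blast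
  have "simple_function M (\<lambda>x. s n x + r *\<^sub>R t n x)" for n
    by (rule simple_function_compose2[OF s(1) t(1)])
  moreover have "AE x in M. (\<lambda>n. s n x + r *\<^sub>R t n x) \<longlonglongrightarrow> f x + r *\<^sub>R g x"
    using s(2) t(2) by eventually_elim (intro tendsto_intros)
  ultimately show ?thesis unfolding strongly_measurable_def by (intro exI[of _ "\<lambda>n x. s n x + r *\<^sub>R t n x"]) auto
qed

lemma strongly_measurable_cong_AE:
  assumes "strongly_measurable M f" "AE x in M. g x = f x"
  shows "strongly_measurable M g"
proof -
  obtain s where s: "\<And>n. simple_function M (s n)" "AE x in M. (\<lambda>n. s n x) \<longlonglongrightarrow> f x"
    using assms(1) unfolding strongly_measurable_def by blast
  have "AE x in M. (\<lambda>n. s n x) \<longlonglongrightarrow> g x"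
    using s(2) assms(2) by eventually_elim simp
  with s(1) show ?thesis unfolding strongly_measurable_def by blast
qed

lemma strongly_measurable_norm:
  fixes f :: "real \<Rightarrow> 'b::real_normed_vector"
  assumes "strongly_measurable (lebesgue_on \<Omega>) f" "\<Omega> \<in> sets lebesgue"
  shows "(\<lambda>x. norm (f x)) \<in> borel_measurable (lebesgue_on \<Omega>)"
proof -
  obtain s where s: "\<And>n. simple_function (lebesgue_on \<Omega>) (s n)"
    "AE x in lebesgue_on \<Omega>. (\<lambda>n. s n x) \<longlonglongrightarrow> f x"
    using assms(1) unfolding strongly_measurable_def by blast
  show ?thesis
  proof (rule borel_measurable_lebesgue_AE_LIMSEQ)
    show "(\<lambda>x. norm (s n x)) \<in> borel_measurable (lebesgue_on \<Omega>)" for n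
      by (rule borel_measurable_simple_function) (rule simple_function_compose1[OF s(1)])
    show "AE x in lebesgue_on \<Omega>. (\<lambda>n. norm (s n x)) \<longlonglongrightarrow> norm (f x)"
      using s(2) by eventually_elim (rule tendsto_norm)
  qed fact
qed

lemma L2_norm_nonneg: "L2_norm T v \<ge> 0"
  by (simp add: L2_norm_def)

lemma L2_norm_square: "(L2_norm T v)\<^sup>2 = (LINT t|lebesgue_on {0<..<T}. (norm (v t))\<^sup>2)"
  by (simp add: L2_norm_def)

lemma L2_cong_AE:
  fixes f g :: "real \<Rightarrow> 'b::real_normed_vector"
  assumes f: "f \<in> L2 T" and eq: "AE t in lebesgue_on {0<..<T}. g t = f t"
  shows "g \<in> L2 T" "L2_norm T g = L2_norm T f"
proof -
  have sf: "strongly_measurable (lebesgue_on {0<..<T}) f" using f by (simp add: L2_def)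
  then have sg: "strongly_measurable (lebesgue_on {0<..<T}) g"
    by (rule strongly_measurable_cong_AE[OF _ eq])
  have m: "(\<lambda>t. (norm (f t))\<^sup>2) \<in> borel_measurable (lebesgue_on {0<..<T})"
    "(\<lambda>t. (norm (g t))\<^sup>2) \<in> borel_measurable (lebesgue_on {0<..<T})"
    by (auto intro!: borel_measurable_power strongly_measurable_norm sf sg)
  have e: "AE t in lebesgue_on {0<..<T}. (norm (g t))\<^sup>2 = (norm (f t))\<^sup>2"
    using eq by eventually_elim simp
  show "g \<in> L2 T"
    using f sg integrable_cong_AE[OF m(2) m(1) e] by (simp add: L2_def)
  show "L2_norm T g = L2_norm T f"
    using integral_cong_AE[OF m(2) m(1) e] by (simp add: L2_norm_def)
qed

lemma L2_add_scaleR: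
  fixes f g :: "real \<Rightarrow> 'b::real_normed_vector"
  assumes f: "f \<in> L2 T" and g: "g \<in> L2 T"
  shows "(\<lambda>t. f t + r *\<^sub>R g t) \<in> L2 T"
    and "L2_norm T (\<lambda>t. f t + r *\<^sub>R g t) \<le> L2_norm T f + \<bar>r\<bar> * L2_norm T g"
proof -
  let ?M = "lebesgue_on {0<..<T}"
  let ?h = "\<lambda>t. f t + r *\<^sub>R g t"
  have if2: "integrable ?M (\<lambda>t. (norm (f t))\<^sup>2)" and ig2: "integrable ?M (\<lambda>t. (norm (g t))\<^sup>2)"
    using f g by (auto simp: L2_def)
  have sh: "strongly_measurable ?M ?h"
    using f g by (intro strongly_measurable_add_scaleR) (auto simp: L2_def)
  then have mh: "(\<lambda>t. (norm (?h t))\<^sup>2) \<in> borel_measurable ?M"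
    by (intro borel_measurable_power strongly_measurable_norm) auto
  \<comment> \<open>Young's inequality with a free weight \<open>c\<close>: taking for \<open>c\<close> the quotient of the two norms
    turns it into Minkowski's inequality after integration\<close>
  have young: "(norm (?h t))\<^sup>2 \<le> (1 + c) * (norm (f t))\<^sup>2 + (1 + 1 / c) * r\<^sup>2 * (norm (g t))\<^sup>2"
    if c: "c > 0" for c t
  proof -
    define x y where "x = norm (f t)" and "y = \<bar>r\<bar> * norm (g t)"
    have "norm (?h t) \<le> x + y"
      unfolding x_def y_def by (rule order_trans[OF norm_triangle_ineq]) simp
    then have "(norm (?h t))\<^sup>2 \<le> (x + y)\<^sup>2" by (intro power_mono) auto
    also have "\<dots> \<le> (1 + c) * x\<^sup>2 + (1 + 1 / c) * y\<^sup>2"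
    proof -
      have "0 \<le> (c * x - y)\<^sup>2 / c" using c by simp
      also have "\<dots> = c * x\<^sup>2 - 2 * x * y + y\<^sup>2 / c"
        using c by (simp add: power2_eq_square field_simps)
      finally show ?thesis by (simp add: power2_eq_square algebra_simps)
    qed
    finally show ?thesis by (simp add: x_def y_def power_mult_distrib mult.assoc)
  qed
  have ih2: "integrable ?M (\<lambda>t. (norm (?h t))\<^sup>2)"
  proof (rule Bochner_Integration.integrable_bound)
    show "integrable ?M (\<lambda>t. (1 + 1) * (norm (f t))\<^sup>2 + (1 + 1 / 1) * r\<^sup>2 * (norm (g t))\<^sup>2)"
      by (intro Bochner_Integration.integrable_add integrable_mult_right if2 ig2)
    show "AE t in ?M. norm ((norm (?h t))\<^sup>2) \<le> norm ((1 + 1) * (norm (f t))\<^sup>2 + (1 + 1 / 1) * r\<^sup>2 * (norm (g t))\<^sup>2)"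
    proof (intro always_eventually allI)
      fix t
      have "norm ((norm (?h t))\<^sup>2) = (norm (?h t))\<^sup>2" by simp
      also have "\<dots> \<le> (1 + 1) * (norm (f t))\<^sup>2 + (1 + 1 / 1) * r\<^sup>2 * (norm (g t))\<^sup>2"
        by (rule young) simp
      also have "\<dots> \<le> norm ((1 + 1) * (norm (f t))\<^sup>2 + (1 + 1 / 1) * r\<^sup>2 * (norm (g t))\<^sup>2)"
        by (simp only: real_norm_def abs_ge_self)
      finally show "norm ((norm (?h t))\<^sup>2) \<le> norm ((1 + 1) * (norm (f t))\<^sup>2 + (1 + 1 / 1) * r\<^sup>2 * (norm (g t))\<^sup>2)" .
    qed
  qed (rule mh)
  show "?h \<in> L2 T" using sh ih2 by (simp add: L2_def)
  show "L2_norm T ?h \<le> L2_norm T f + \<bar>r\<bar> * L2_norm T g"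
  proof (rule field_le_epsilon)
    fix e :: real assume e: "e > 0"
    \<comment> \<open>the summands \<open>e / 2\<close> keep the weight \<open>q / p\<close> defined and positive when a norm vanishes\<close>
    define p q where "p = L2_norm T f + e / 2" and "q = \<bar>r\<bar> * L2_norm T g + e / 2"
    have pq: "p > 0" "q > 0" using e by (auto simp: p_def q_def L2_norm_nonneg add_nonneg_pos)
    define c where "c = q / p"
    have c: "c > 0" using pq by (simp add: c_def)
    have cp: "c * p = q" "q / c = p" using pq by (simp_all add: c_def)
    have "(L2_norm T ?h)\<^sup>2 \<le> (LINT t|?M. (1 + c) * (norm (f t))\<^sup>2 + (1 + 1 / c) * r\<^sup>2 * (norm (g t))\<^sup>2)"
      unfolding L2_norm_square
      by (rule integral_mono[OF ih2 _ young[OF c]])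
        (intro Bochner_Integration.integrable_add integrable_mult_right if2 ig2)
    also have "\<dots> = (1 + c) * (L2_norm T f)\<^sup>2 + (1 + 1 / c) * (\<bar>r\<bar> * L2_norm T g)\<^sup>2"
      using if2 ig2 by (simp add: L2_norm_square power_mult_distrib mult.assoc)
    also have "\<dots> \<le> (1 + c) * p\<^sup>2 + (1 + 1 / c) * q\<^sup>2"
      using c e by (intro add_mono mult_left_mono power_mono) (auto simp: p_def q_def L2_norm_nonneg)
    also have "\<dots> = p\<^sup>2 + (c * p) * p + q\<^sup>2 + (q / c) * q"
      by (simp add: power2_eq_square algebra_simps)
    also have "\<dots> = (p + q)\<^sup>2"
      unfolding cp by (simp add: power2_eq_square algebra_simps)
    finally have "L2_norm T ?h \<le> p + q"
      by (rule power2_le_imp_le) (use pq in simp)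
    then show "L2_norm T ?h \<le> L2_norm T f + \<bar>r\<bar> * L2_norm T g + e" by (simp add: p_def q_def)
  qed
qed

lemma lebesgue_translate: "lebesgue = distr lebesgue lebesgue (\<lambda>x. x - a :: real)"
  using lebesgue_real_affine[of 1 "- a"] by (simp add: density_1 algebra_simps)

lemma measurable_translate: "(\<lambda>x. x - a :: real) \<in> lebesgue \<rightarrow>\<^sub>M lebesgue"
  using lebesgue_affine_measurable[of "\<lambda>_. 1" "- a"] by (simp add: algebra_simps)

text \<open>Extended by zero to the whole line, \<open>v\<close> is merely translated, which preserves Lebesgue
  measure; only the part that leaves the interval is lost.\<close>

lemma L2_delay:
  fixes v :: "real \<Rightarrow> 'b::real_normed_vector" and a :: real
  assumes v: "v \<in> L2 T"
  defines "w \<equiv> \<lambda>t. if t - a \<in> {0<..<T} then v (t - a) else 0"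
  shows "w \<in> L2 T" "L2_norm T w \<le> L2_norm T v"
proof -
  let ?\<Omega> = "{0<..<T}" and ?sh = "\<lambda>x::real. x - a"
  have \<Omega>: "?\<Omega> \<in> sets lebesgue" by simp
  have D: "distr lebesgue lebesgue ?sh = lebesgue" by (rule lebesgue_translate[symmetric])
  define V where "V x = (if x \<in> ?\<Omega> then v x else 0)" for x
  have w: "w t = V (t - a)" for t by (simp add: w_def V_def)
  obtain s where s: "\<And>n. simple_function (lebesgue_on ?\<Omega>) (s n)"
    "AE x in lebesgue_on ?\<Omega>. (\<lambda>n. s n x) \<longlonglongrightarrow> v x"
    using v unfolding L2_def strongly_measurable_def by blast
  define s' where "s' n x = (if x \<in> ?\<Omega> then s n x else 0)" for n x
  have s': "simple_function lebesgue (s' n)" for n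
    unfolding simple_function_def
  proof (intro conjI ballI)
    have fin: "finite (s n ` ?\<Omega>)" using simple_functionD(1)[OF s(1)[of n]] by simp
    show "finite (s' n ` space lebesgue)"
      by (rule finite_subset[of _ "insert 0 (s n ` ?\<Omega>)"]) (use fin in \<open>auto simp: s'_def\<close>)
    fix y
    have "s n -` {y} \<inter> ?\<Omega> \<in> sets (lebesgue_on ?\<Omega>)"
      using simple_functionD(2)[OF s(1)[of n]] by simp
    then have m: "s n -` {y} \<inter> ?\<Omega> \<in> sets lebesgue"
      by (simp add: sets_restrict_space_iff)
    have "s' n -` {y} \<inter> space lebesgue = (s n -` {y} \<inter> ?\<Omega>) \<union> (if y = 0 then - ?\<Omega> else {})"
      by (auto simp: s'_def split: if_splits)
    also have "\<dots> \<in> sets lebesgue"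
      using m \<Omega> by (auto intro!: sets.Un simp: Compl_in_sets_lebesgue)
    finally show "s' n -` {y} \<inter> space lebesgue \<in> sets lebesgue" .
  qed
  have "AE x in lebesgue. (\<lambda>n. s' n x) \<longlonglongrightarrow> V x"
    using s(2) by (auto simp: AE_restrict_space_iff s'_def V_def elim!: eventually_mono)
  then have "AE x in lebesgue. (\<lambda>n. s' n (?sh x)) \<longlonglongrightarrow> V (?sh x)"
    using AE_distrD[OF measurable_translate[of a], of "\<lambda>x. (\<lambda>n. s' n x) \<longlonglongrightarrow> V x"]
    unfolding D by blast
  then have lim: "AE x in lebesgue_on ?\<Omega>. (\<lambda>n. s' n (?sh x)) \<longlonglongrightarrow> w x"
    by (auto simp: AE_restrict_space_iff w elim!: eventually_mono)
  have "simple_function (lebesgue_on ?\<Omega>) (\<lambda>x. s' n (?sh x))" for n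
    by (rule simple_function_comp[OF _ s'])
      (rule measurable_restrict_space1[OF measurable_translate])
  with lim have sw: "strongly_measurable (lebesgue_on ?\<Omega>) w"
    unfolding strongly_measurable_def by (intro exI[of _ "\<lambda>n x. s' n (?sh x)"]) auto
  define F where "F x = (norm (V x))\<^sup>2" for x
  have F_eq: "F = (\<lambda>x. if x \<in> ?\<Omega> then (norm (v x))\<^sup>2 else 0)"
    by (auto simp: F_def V_def)
  have F: "integrable lebesgue F"
    unfolding F_eq Lebesgue_Measure.integrable_restrict_UNIV[OF \<Omega>] using v by (simp add: L2_def)
  have intF: "integral\<^sup>L lebesgue F = (L2_norm T v)\<^sup>2"
    unfolding F_eq Lebesgue_Measure.integral_restrict_UNIV[OF \<Omega>] L2_norm_square ..
  have Fm: "F \<in> borel_measurable lebesgue" using F by (rule borel_measurable_integrable)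
  have Fs: "integrable lebesgue (\<lambda>x. F (?sh x))"
    using integrable_distr_eq[OF measurable_translate[of a] Fm] F unfolding D by blast
  have intFs: "(LINT x|lebesgue. F (?sh x)) = integral\<^sup>L lebesgue F"
    using integral_distr[OF measurable_translate[of a] Fm] unfolding D by simp
  have Fs': "integrable lebesgue (\<lambda>x. if x \<in> ?\<Omega> then F (?sh x) else 0)"
  proof -
    have "(\<lambda>x. if x \<in> ?\<Omega> then F (?sh x) else 0) = (\<lambda>x. indicator ?\<Omega> x *\<^sub>R F (?sh x))"
      by (auto simp: fun_eq_iff)
    then show ?thesis using integrable_mult_indicator[OF \<Omega> Fs] by simp
  qed
  then have iw: "integrable (lebesgue_on ?\<Omega>) (\<lambda>x. (norm (w x))\<^sup>2)"
    unfolding Lebesgue_Measure.integrable_restrict_UNIV[OF \<Omega>] by (simp add: w F_def)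
  show "w \<in> L2 T" using sw iw by (simp add: L2_def)
  have "(L2_norm T w)\<^sup>2 = (LINT x|lebesgue. (if x \<in> ?\<Omega> then F (?sh x) else 0))"
    unfolding Lebesgue_Measure.integral_restrict_UNIV[OF \<Omega>] L2_norm_square by (simp add: w F_def)
  also have "\<dots> \<le> (LINT x|lebesgue. F (?sh x))"
    by (rule integral_mono[OF Fs' Fs]) (auto simp: F_def)
  also have "\<dots> = (L2_norm T v)\<^sup>2" by (simp add: intFs intF)
  finally show "L2_norm T w \<le> L2_norm T v"
    by (rule power2_le_imp_le) (rule L2_norm_nonneg)
qed

section \<open>An equivalent norm that makes the semigroup a contraction\<close>

locale exponentially_stable = extrapolation D A S M pair emb
  for D :: "'h::complex_hilbert set" and A S M and pair :: "'e::complex_banach \<Rightarrow> 'h \<Rightarrow> complex" and emb +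
  fixes \<omega> :: real
  assumes M_nonneg: "M \<ge> 0" and \<omega>_nonneg: "\<omega> \<ge> 0"
    and decay: "\<And>t x. t \<ge> 0 \<Longrightarrow> norm (S t x) \<le> M * exp (- \<omega> * t) * norm x"
begin

text \<open>Absorbing the decay rate into the norm replaces the bound \<open>M exp (- \<omega> t)\<close> on \<open>S(t)\<close> by
  \<open>exp (- \<omega> t)\<close>. The constant \<open>M\<close> then enters only where a given state is first measured in the
  new norm, and it does not accumulate along the iteration.\<close>

definition orbit_norm :: "'h \<Rightarrow> real" where
  "orbit_norm x = (SUP r\<in>{0..}. exp (\<omega> * r) * norm (S r x))"

lemma weighted_orbit_le: "r \<ge> 0 \<Longrightarrow> exp (\<omega> * r) * norm (S r x) \<le> M * norm x"
proof -
  assume "r \<ge> 0"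
  then have "exp (\<omega> * r) * norm (S r x) \<le> exp (\<omega> * r) * (M * exp (- \<omega> * r) * norm x)"
    by (intro mult_left_mono decay) auto
  also have "\<dots> = (exp (\<omega> * r) * exp (- \<omega> * r)) * (M * norm x)" by (simp only: ac_simps)
  also have "\<dots> = M * norm x" by (simp flip: exp_add)
  finally show ?thesis .
qed

lemma weighted_orbit_le_orbit_norm: "r \<ge> 0 \<Longrightarrow> exp (\<omega> * r) * norm (S r x) \<le> orbit_norm x"
  unfolding orbit_norm_def
  by (rule cSUP_upper) (auto intro!: bdd_aboveI2 weighted_orbit_le)

lemma orbit_norm_leI: "(\<And>r. r \<ge> 0 \<Longrightarrow> exp (\<omega> * r) * norm (S r x) \<le> c) \<Longrightarrow> orbit_norm x \<le> c"
  unfolding orbit_norm_def by (rule cSUP_least) auto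

lemma orbit_norm_le: "orbit_norm x \<le> M * norm x"
  by (rule orbit_norm_leI) (rule weighted_orbit_le)

lemma norm_le_orbit_norm: "norm x \<le> orbit_norm x"
  using weighted_orbit_le_orbit_norm[of 0 x] by simp

lemma orbit_norm_S: "t \<ge> 0 \<Longrightarrow> orbit_norm (S t x) \<le> exp (- \<omega> * t) * orbit_norm x"
proof (rule orbit_norm_leI)
  fix r :: real assume "t \<ge> 0" "r \<ge> 0"
  then have "exp (- \<omega> * t) * (exp (\<omega> * (r + t)) * norm (S (r + t) x)) \<le> exp (- \<omega> * t) * orbit_norm x"
    by (intro mult_left_mono weighted_orbit_le_orbit_norm) auto
  moreover have "exp (- \<omega> * t) * (exp (\<omega> * (r + t)) * norm (S (r + t) x)) = exp (\<omega> * r) * norm (S r (S t x))"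
    using \<open>t \<ge> 0\<close> \<open>r \<ge> 0\<close> by (simp add: S_add distrib_left exp_add exp_minus)
  ultimately show "exp (\<omega> * r) * norm (S r (S t x)) \<le> exp (- \<omega> * t) * orbit_norm x" by (simp only:)
qed

lemma orbit_norm_add_scaleR: "orbit_norm (x + k *\<^sub>R y) \<le> orbit_norm x + \<bar>k\<bar> * orbit_norm y"
proof (rule orbit_norm_leI)
  fix r :: real assume r: "r \<ge> 0"
  interpret Sr: bounded_linear "S r" by (rule bounded_linear_S[OF r])
  have "norm (S r (x + k *\<^sub>R y)) \<le> norm (S r x) + \<bar>k\<bar> * norm (S r y)"
    unfolding Sr.add Sr.scaleR by (rule order_trans[OF norm_triangle_ineq]) simp
  then have "exp (\<omega> * r) * norm (S r (x + k *\<^sub>R y)) \<le> exp (\<omega> * r) * (norm (S r x) + \<bar>k\<bar> * norm (S r y))"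
    by (rule mult_left_mono) simp
  also have "\<dots> = exp (\<omega> * r) * norm (S r x) + \<bar>k\<bar> * (exp (\<omega> * r) * norm (S r y))"
    by (simp add: algebra_simps)
  also have "\<dots> \<le> orbit_norm x + \<bar>k\<bar> * orbit_norm y"
    by (intro add_mono mult_left_mono weighted_orbit_le_orbit_norm r) auto
  finally show "exp (\<omega> * r) * norm (S r (x + k *\<^sub>R y)) \<le> orbit_norm x + \<bar>k\<bar> * orbit_norm y" .
qed

end

section \<open>The controlled system\<close>

locale control_system = exponentially_stable D A S M pair emb \<omega>
  for D :: "'h::complex_hilbert set" and A S M
    and pair :: "'e::complex_banach \<Rightarrow> 'h \<Rightarrow> complex" and emb \<omega> +
  fixes Se :: "real \<Rightarrow> 'e \<Rightarrow> 'e" and C :: "'u::complex_hilbert \<Rightarrow> 'e"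
    and DC :: "'h set" and Cs :: "'h \<Rightarrow> 'u" and \<tau> C1 C2 C3 :: real
  assumes \<tau>: "\<tau> > 0"
    and Se: "C0_semigroup Se"
    and Se_emb: "\<And>t x. t \<ge> 0 \<Longrightarrow> Se t (emb x) = emb (S t x)"
    and control: "control_pair D A pair C DC Cs"
    and H1: "hyp_H1 emb Se C \<tau> C1"
    and H2: "hyp_H2 emb Se C DC Cs \<tau> C3"
    and H3: "hyp_H3 S DC Cs \<tau> C2"
begin

lemma bounded_linear_Se: "t \<ge> 0 \<Longrightarrow> bounded_linear (Se t)"
  using Se by (auto simp: C0_semigroup_def bounded_clinear_def)

lemma Se_add: "s \<ge> 0 \<Longrightarrow> t \<ge> 0 \<Longrightarrow> Se s (Se t x) = Se (s + t) x"
  using Se by (auto simp: C0_semigroup_def)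

lemma bounded_linear_C: "bounded_linear C"
  using control by (auto simp: control_pair_def bounded_clinear_def)

lemma C_0 [simp]: "C 0 = 0"
  by (rule linear_0[OF bounded_linear.linear[OF bounded_linear_C]])

lemma Cs_add_scaleR:
  assumes "x \<in> DC" "y \<in> DC"
  shows "Cs (x + r *\<^sub>R y) = Cs x + r *\<^sub>R Cs y"
proof -
  have "complex_of_real r *\<^sub>C y \<in> DC"
    using control assms(2) by (auto simp: control_pair_def csubspace_def)
  then show ?thesis
    using control assms unfolding control_pair_def clinear_on_def
    by (metis scaleC_of_real)
qed

lemma has_Phi_pair:
  "z \<in> D' \<Longrightarrow> has_Phi Se C t v e \<Longrightarrow>
    ((\<lambda>\<sigma>. pair (Se (t - \<sigma>) (C (v \<sigma>))) z) has_integral pair e z) {0..t}"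
  by (rule has_Phi_functional[OF bounded_linear_pair])

text \<open>The delayed input vanishes on \<open>[0, \<tau> - t]\<close> and then repeats \<open>v\<close>, so that it produces at
  time \<open>\<tau>\<close> the state that \<open>v\<close> produces at time \<open>t\<close>. Hence the bound at time \<open>\<tau>\<close> holds at all
  earlier times with the same constant.\<close>

lemma norm_Phi_le:
  assumes v: "v \<in> L2 \<tau>" and t: "t \<in> {0..\<tau>}" and Phi: "has_Phi Se C t v (emb x)"
  shows "norm x \<le> C1 * L2_norm \<tau> v"
proof -
  define a where "a = \<tau> - t"
  have a: "0 \<le> a" "a \<le> \<tau>" using t by (auto simp: a_def)
  define w where "w = (\<lambda>\<sigma>. if \<sigma> - a \<in> {0<..<\<tau>} then v (\<sigma> - a) else 0)"
  have w: "w \<in> L2 \<tau>" "L2_norm \<tau> w \<le> L2_norm \<tau> v"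
    unfolding w_def by (rule L2_delay[OF v])+
  obtain \<phi> where \<phi>: "\<forall>t\<in>{0..\<tau>}. has_Phi Se C t w (emb (\<phi> t))" "norm (\<phi> \<tau>) \<le> C1 * L2_norm \<tau> w"
    using H1 w(1) unfolding hyp_H1_def by blast
  have "emb (\<phi> \<tau>) = emb x"
  proof (rule pair_separates)
    fix z assume z: "z \<in> D'"
    let ?F = "\<lambda>\<sigma>. pair (Se (\<tau> - \<sigma>) (C (w \<sigma>))) z"
    have "pair 0 z = 0" by (rule linear_0[OF bounded_linear.linear[OF bounded_linear_pair[OF z]]])
    then have F0: "?F \<sigma> = 0" if "\<sigma> \<in> {0..a}" for \<sigma>
      using that a linear_0[OF bounded_linear.linear[OF bounded_linear_Se[of "\<tau> - \<sigma>"]]]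
      by (simp add: w_def)
    have "(?F has_integral 0) {0..a}"
      by (rule has_integral_is_0) (rule F0)
    moreover have "(?F has_integral pair (emb x) z) {a..\<tau>}"
    proof -
      have "((\<lambda>\<sigma>. pair (Se (t - (\<sigma> + - a)) (C (v (\<sigma> + - a)))) z) has_integral pair (emb x) z) {0 - - a..t - - a}"
        by (rule has_integral_shift_real_ivl[OF has_Phi_pair[OF z Phi]])
      then have "((\<lambda>\<sigma>. pair (Se (t - (\<sigma> + - a)) (C (v (\<sigma> + - a)))) z) has_integral pair (emb x) z) {a..\<tau>}"
        by (simp add: a_def)
      \<comment> \<open>the integrands may differ at the two end points\<close>
      then show ?thesis
        by (rule has_integral_spike_finite[of "{a, \<tau>}", rotated -1])
          (use a t in \<open>auto simp: w_def a_def algebra_simps\<close>)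
    qed
    ultimately have "(?F has_integral 0 + pair (emb x) z) {0..\<tau>}"
      by (rule has_integral_combine[OF a])
    moreover have "(?F has_integral pair (emb (\<phi> \<tau>)) z) {0..\<tau>}"
      by (rule has_Phi_pair[OF z]) (use \<phi>(1) \<tau> in simp)
    ultimately have "0 + pair (emb x) z = pair (emb (\<phi> \<tau>)) z"
      by (rule has_integral_unique)
    then show "pair (emb (\<phi> \<tau>)) z = pair (emb x) z" by simp
  qed
  then have "norm x \<le> C1 * L2_norm \<tau> w" using \<phi>(2) by (simp add: emb_inject)
  also have "\<dots> \<le> C1 * L2_norm \<tau> v"
    using H1 w(2) by (intro mult_left_mono) (auto simp: hyp_H1_def)
  finally show ?thesis .
qed

text \<open>What was steered up to time \<open>r\<close> evolves freely for a further time \<open>s\<close>, and the input after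
  time \<open>r\<close> acts as if it started at \<open>0\<close>. Against a fixed \<open>z\<close> this is the splitting of a scalar
  integral at \<open>r\<close>.\<close>

lemma Phi_cocycle:
  assumes r: "r \<ge> 0" and s: "s \<ge> 0"
    and e: "has_Phi Se C r v e" and e': "has_Phi Se C s (\<lambda>\<sigma>. v (r + \<sigma>)) e'"
    and e'': "has_Phi Se C (r + s) v e''"
  shows "e'' = Se s e + e'"
proof (rule pair_separates)
  fix z assume z: "z \<in> D'"
  let ?F = "\<lambda>\<sigma>. pair (Se (r + s - \<sigma>) (C (v \<sigma>))) z"
  have "((\<lambda>\<sigma>. pair (Se s (Se (r - \<sigma>) (C (v \<sigma>)))) z) has_integral pair (Se s e) z) {0..r}"
    by (rule has_Phi_functional[OF bounded_linear_compose[OF bounded_linear_pair[OF z] bounded_linear_Se[OF s]] e])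
  then have "(?F has_integral pair (Se s e) z) {0..r}"
    by (rule has_integral_eq[rotated]) (use s in \<open>auto simp: Se_add algebra_simps\<close>)
  moreover have "(?F has_integral pair e' z) {r..r + s}"
    using has_integral_shift_real_ivl[OF has_Phi_pair[OF z e'], of "- r"] by (simp add: algebra_simps)
  ultimately have "(?F has_integral pair (Se s e) z + pair e' z) {0..r + s}"
    by (rule has_integral_combine[rotated 2]) (use r s in auto)
  with has_Phi_pair[OF z e''] have "pair e'' z = pair (Se s e) z + pair e' z"
    by (rule has_integral_unique)
  then show "pair e'' z = pair (Se s e + e') z" by (simp only: pair_add[OF z])
qed

end

section \<open>Solutions of the delay system, one delay interval at a time\<close>

locale delay_solution = control_system D A S M pair emb \<omega> Se C DC Cs \<tau> C1 C2 C3
  for D :: "'h::complex_hilbert set" and A S M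
    and pair :: "'e::complex_banach \<Rightarrow> 'h \<Rightarrow> complex" and emb \<omega> Se
    and C :: "'u::complex_hilbert \<Rightarrow> 'e" and DC Cs \<tau> C1 C2 C3 +
  fixes k :: real and U0 :: 'h and f :: "real \<Rightarrow> 'u" and U :: "real \<Rightarrow> 'h"
  assumes f: "f \<in> L2 \<tau>"
    and mild: "mild_solution emb S Se C DC Cs \<tau> k U0 f U"
begin

definition input :: "real \<Rightarrow> 'u" where
  "input s = (if s < \<tau> then f s else Cs (U (s - \<tau>)))"

text \<open>The input during the \<open>n\<close>-th delay interval, in the time elapsed since \<open>n * \<tau>\<close>.\<close>

definition window :: "nat \<Rightarrow> real \<Rightarrow> 'u" where
  "window n s = input (real n * \<tau> + s)"

lemma duhamel:
  assumes "t \<ge> 0"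
  obtains e where "has_Phi Se C t input e" "emb (U t) = emb (S t U0) + k *\<^sub>R e"
  using mild assms unfolding mild_solution_def input_def by blast

text \<open>The integral over \<open>[0, 0]\<close> vanishes; the initial condition is part of the Duhamel
  formula.\<close>

lemma U_0: "U 0 = U0"
proof -
  obtain e where e: "has_Phi Se C 0 input e" "emb (U 0) = emb (S 0 U0) + k *\<^sub>R e"
    by (rule duhamel[of 0]) auto
  have "e = 0"
  proof (rule pair_separates)
    fix z assume z: "z \<in> D'"
    have "((\<lambda>\<sigma>. pair (Se (0 - \<sigma>) (C (input \<sigma>))) z) has_integral pair e z) {0..0}"
      by (rule has_Phi_pair[OF z e(1)])
    then have "pair e z = 0"
      by (rule has_integral_unique) (simp add: has_integral_refl)
    then show "pair e z = pair 0 z"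
      using linear_0[OF bounded_linear.linear[OF bounded_linear_pair[OF z]]] by simp
  qed
  then show ?thesis using e(2) by (simp add: emb_inject)
qed

lemma window_0: "window 0 \<in> L2 \<tau>" "L2_norm \<tau> (window 0) = L2_norm \<tau> f"
proof -
  have "AE t in lebesgue_on {0<..<\<tau>}. window 0 t = f t"
    by (rule AE_I2) (auto simp: window_def input_def)
  from L2_cong_AE[OF f this] show "window 0 \<in> L2 \<tau>" "L2_norm \<tau> (window 0) = L2_norm \<tau> f" .
qed

text \<open>Subtracting the Duhamel formulas at \<open>n * \<tau>\<close> and at \<open>n * \<tau> + s\<close> by means of the cocycle
  identity expresses the solution through its state at \<open>n * \<tau>\<close> and the current window. The forced part \<open>\<phi>\<close>
  is kept as a whole function of \<open>s\<close>, since the hypothesis on the observed response concerns the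
  whole interval.\<close>

lemma restart:
  assumes w: "window n \<in> L2 \<tau>"
  obtains \<phi> where "\<And>s. s \<in> {0..\<tau>} \<Longrightarrow> has_Phi Se C s (window n) (emb (\<phi> s))"
    and "\<And>s. s \<in> {0..\<tau>} \<Longrightarrow> norm (\<phi> s) \<le> C1 * L2_norm \<tau> (window n)"
    and "\<And>s. s \<in> {0..\<tau>} \<Longrightarrow> U (real n * \<tau> + s) = S s (U (real n * \<tau>)) + k *\<^sub>R \<phi> s"
proof -
  obtain \<phi> where \<phi>: "\<And>s. s \<in> {0..\<tau>} \<Longrightarrow> has_Phi Se C s (window n) (emb (\<phi> s))"
    using H1 w unfolding hyp_H1_def by blast
  have "U (real n * \<tau> + s) = S s (U (real n * \<tau>)) + k *\<^sub>R \<phi> s" if s: "s \<in> {0..\<tau>}" for s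
  proof -
    let ?r = "real n * \<tau>"
    have r: "?r \<ge> 0" and s0: "s \<ge> 0" using \<tau> s by auto
    obtain e where e: "has_Phi Se C ?r input e" "emb (U ?r) = emb (S ?r U0) + k *\<^sub>R e"
      by (rule duhamel[OF r])
    obtain e' where e': "has_Phi Se C (?r + s) input e'" "emb (U (?r + s)) = emb (S (?r + s) U0) + k *\<^sub>R e'"
      by (rule duhamel[of "?r + s"]) (use r s0 in auto)
    interpret Ses: bounded_linear "Se s" by (rule bounded_linear_Se[OF s0])
    have "has_Phi Se C s (\<lambda>\<sigma>. input (?r + \<sigma>)) (emb (\<phi> s))"
      using \<phi>[OF s] by (simp add: window_def[abs_def])
    then have "e' = Se s e + emb (\<phi> s)"
      by (rule Phi_cocycle[OF r s0 e(1) _ e'(1)])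
    then have "emb (U (?r + s)) = emb (S s (S ?r U0)) + k *\<^sub>R (Se s e + emb (\<phi> s))"
      using e'(2) S_add[OF s0 r] by (simp add: add.commute)
    also have "\<dots> = Se s (emb (U ?r)) + k *\<^sub>R emb (\<phi> s)"
      by (simp add: e(2) Ses.add Ses.scaleR Se_emb[OF s0] scaleR_add_right)
    also have "\<dots> = emb (S s (U ?r) + k *\<^sub>R \<phi> s)"
      by (simp add: Se_emb[OF s0] emb_add_scaleR)
    finally show ?thesis by (simp add: emb_inject)
  qed
  then show thesis using \<phi> norm_Phi_le[OF w] by (intro that) auto
qed

text \<open>The next window observes the current interval. The free and the forced part lie in the
  domain of \<open>Cs\<close> for almost every time, which allows \<open>Cs\<close> to be applied to each of them.\<close>

lemma window_Suc:
  assumes w: "window n \<in> L2 \<tau>"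
  shows "window (Suc n) \<in> L2 \<tau>"
    and "L2_norm \<tau> (window (Suc n)) \<le> C2 * norm (U (real n * \<tau>)) + \<bar>k\<bar> * (C3 * L2_norm \<tau> (window n))"
proof -
  obtain \<phi> where \<phi>: "\<And>s. s \<in> {0..\<tau>} \<Longrightarrow> has_Phi Se C s (window n) (emb (\<phi> s))"
    and U: "\<And>s. s \<in> {0..\<tau>} \<Longrightarrow> U (real n * \<tau> + s) = S s (U (real n * \<tau>)) + k *\<^sub>R \<phi> s"
    by (rule restart[OF w]) blast
  let ?x = "U (real n * \<tau>)"
  have free: "AE s in lebesgue_on {0<..<\<tau>}. S s ?x \<in> DC" "(\<lambda>s. Cs (S s ?x)) \<in> L2 \<tau>"
    "L2_norm \<tau> (\<lambda>s. Cs (S s ?x)) \<le> C2 * norm ?x"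
    using H3 by (auto simp: hyp_H3_def)
  have forced: "AE s in lebesgue_on {0<..<\<tau>}. \<phi> s \<in> DC" "(\<lambda>s. Cs (\<phi> s)) \<in> L2 \<tau>"
    "L2_norm \<tau> (\<lambda>s. Cs (\<phi> s)) \<le> C3 * L2_norm \<tau> (window n)"
    using H2 w \<phi> unfolding hyp_H2_def by blast+
  have shift: "window (Suc n) s = Cs (U (real n * \<tau> + s))" if "s \<in> {0<..<\<tau>}" for s
  proof -
    have "real n * \<tau> \<ge> 0" using \<tau> by simp
    then have "\<not> real (Suc n) * \<tau> + s < \<tau>" using that by (auto simp: distrib_right not_less)
    then show ?thesis by (simp add: window_def input_def algebra_simps)
  qed
  have eq: "AE s in lebesgue_on {0<..<\<tau>}. window (Suc n) s = Cs (S s ?x) + k *\<^sub>R Cs (\<phi> s)"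
    using free(1) forced(1) AE_space[of "lebesgue_on {0<..<\<tau>}"]
    by eventually_elim (simp add: shift U Cs_add_scaleR)
  note sum = L2_add_scaleR[OF free(2) forced(2), of k]
  show "window (Suc n) \<in> L2 \<tau>" by (rule L2_cong_AE(1)[OF sum(1) eq])
  have "L2_norm \<tau> (window (Suc n)) \<le> L2_norm \<tau> (\<lambda>s. Cs (S s ?x)) + \<bar>k\<bar> * L2_norm \<tau> (\<lambda>s. Cs (\<phi> s))"
    using sum(2) L2_cong_AE(2)[OF sum(1) eq] by simp
  also have "\<dots> \<le> C2 * norm ?x + \<bar>k\<bar> * (C3 * L2_norm \<tau> (window n))"
    by (intro add_mono mult_left_mono free forced) auto
  finally show "L2_norm \<tau> (window (Suc n)) \<le> C2 * norm ?x + \<bar>k\<bar> * (C3 * L2_norm \<tau> (window n))" .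
qed

lemma window_L2: "window n \<in> L2 \<tau>"
  by (induction n) (auto intro: window_0 window_Suc)

lemma restart_at:
  assumes s: "s \<in> {0..\<tau>}"
  obtains y where "norm y \<le> C1 * L2_norm \<tau> (window n)"
    and "U (real n * \<tau> + s) = S s (U (real n * \<tau>)) + k *\<^sub>R y"
proof -
  obtain \<phi> where "\<And>s. s \<in> {0..\<tau>} \<Longrightarrow> norm (\<phi> s) \<le> C1 * L2_norm \<tau> (window n)"
    and "\<And>s. s \<in> {0..\<tau>} \<Longrightarrow> U (real n * \<tau> + s) = S s (U (real n * \<tau>)) + k *\<^sub>R \<phi> s"
    by (rule restart[OF window_L2[of n]]) blast
  then show thesis using s by (intro that[of "\<phi> s"])
qed

lemma orbit_norm_U_Suc:
  "orbit_norm (U (real (Suc n) * \<tau>)) \<le>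
    exp (- \<omega> * \<tau>) * orbit_norm (U (real n * \<tau>)) + \<bar>k\<bar> * (M * (C1 * L2_norm \<tau> (window n)))"
proof -
  obtain y where y: "norm y \<le> C1 * L2_norm \<tau> (window n)"
    and U: "U (real n * \<tau> + \<tau>) = S \<tau> (U (real n * \<tau>)) + k *\<^sub>R y"
    by (rule restart_at[of \<tau> n]) (use \<tau> in auto)
  have M: "M * norm (y) \<le> M * (C1 * L2_norm \<tau> (window n))"
    by (rule mult_left_mono[OF y M_nonneg])
  have "U (real (Suc n) * \<tau>) = S \<tau> (U (real n * \<tau>)) + k *\<^sub>R y"
    using U by (simp add: distrib_right add.commute)
  then have "orbit_norm (U (real (Suc n) * \<tau>)) \<le> orbit_norm (S \<tau> (U (real n * \<tau>))) + \<bar>k\<bar> * orbit_norm (y)"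
    using orbit_norm_add_scaleR by metis
  also have "\<dots> \<le> exp (- \<omega> * \<tau>) * orbit_norm (U (real n * \<tau>)) + \<bar>k\<bar> * (M * (C1 * L2_norm \<tau> (window n)))"
    using \<tau> by (intro add_mono mult_left_mono orbit_norm_S order_trans[OF orbit_norm_le M]) auto
  finally show ?thesis .
qed

lemma norm_U_le:
  assumes s: "s \<in> {0..\<tau>}"
  shows "norm (U (real n * \<tau> + s)) \<le> orbit_norm (U (real n * \<tau>)) + \<bar>k\<bar> * (C1 * L2_norm \<tau> (window n))"
proof -
  let ?x = "U (real n * \<tau>)"
  obtain y where y: "norm y \<le> C1 * L2_norm \<tau> (window n)"
    and U: "U (real n * \<tau> + s) = S s ?x + k *\<^sub>R y"
    by (rule restart_at[OF s])
  have "norm (U (real n * \<tau> + s)) \<le> norm (S s ?x) + \<bar>k\<bar> * norm (y)"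
    unfolding U by (rule order_trans[OF norm_triangle_ineq]) simp
  moreover have "norm (S s ?x) \<le> exp (\<omega> * s) * norm (S s ?x)"
    using \<omega>_nonneg s by (simp add: mult_le_cancel_right1)
  moreover have "\<dots> \<le> orbit_norm ?x"
    using s by (intro weighted_orbit_le_orbit_norm) auto
  moreover have "\<bar>k\<bar> * norm (y) \<le> \<bar>k\<bar> * (C1 * L2_norm \<tau> (window n))"
    by (rule mult_left_mono[OF y]) simp
  ultimately show ?thesis by linarith
qed

text \<open>The pair \<open>(a, b)\<close> of the state norm and the scaled window norm obeys a linear recursion
  with the nonnegative matrix whose rows are \<open>(q, 1)\<close> and \<open>(\<kappa>, \<kappa>)\<close>. Multiplied from the left by
  the weights \<open>(1, 1 / q)\<close> this matrix gives \<open>(q + \<kappa> / q, 1 + \<kappa> / q)\<close>. As \<open>q \<le> 1\<close>, this is at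
  most \<open>q + \<kappa> / q\<close> times the weights, so the weighted sum \<open>a + b / q\<close> decays with that
  factor.\<close>

lemma norm_U_geometric:
  fixes M' C4 q \<kappa> :: real
  assumes M': "M' \<ge> 1" "M' \<ge> M" and C4: "C4 \<ge> C2" "C3 \<le> M' * C1 * C4"
    and q: "q = exp (- \<omega> * \<tau>)" and \<kappa>: "\<kappa> = \<bar>k\<bar> * M' * C1 * C4"
    and s: "s \<in> {0..\<tau>}"
  shows "norm (U (real n * \<tau> + s)) \<le>
    (q + \<kappa> / q) ^ n * (M' * norm U0 + \<bar>k\<bar> * M' * C1 * L2_norm \<tau> f / q)"
proof -
  have C1: "C1 > 0" using H1 by (simp add: hyp_H1_def)
  have C2: "C2 > 0" using H3 by (simp add: hyp_H3_def)
  have q01: "0 < q" "q \<le> 1" using \<omega>_nonneg \<tau> by (auto simp: q)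
  define a b where "a n = orbit_norm (U (real n * \<tau>))"
    and "b n = \<bar>k\<bar> * M' * C1 * L2_norm \<tau> (window n)" for n
  have g: "\<bar>k\<bar> * M' * C1 \<ge> 0" using M' C1 by simp
  have a0: "a n \<ge> 0" for n
    unfolding a_def by (rule order_trans[OF norm_ge_zero norm_le_orbit_norm])
  have b0: "b n \<ge> 0" for n
    unfolding b_def by (rule mult_nonneg_nonneg[OF g L2_norm_nonneg])
  have \<kappa>0: "\<kappa> \<ge> 0" unfolding \<kappa> by (rule mult_nonneg_nonneg[OF g]) (use C2 C4 in simp)
  have "b n = \<bar>k\<bar> * (M' * (C1 * L2_norm \<tau> (window n)))" for n
    by (simp add: b_def mult.assoc)
  moreover have "\<bar>k\<bar> * (M * (C1 * L2_norm \<tau> (window n))) \<le> \<bar>k\<bar> * (M' * (C1 * L2_norm \<tau> (window n)))"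
    and "\<bar>k\<bar> * (1 * (C1 * L2_norm \<tau> (window n))) \<le> \<bar>k\<bar> * (M' * (C1 * L2_norm \<tau> (window n)))" for n
    using M' C1 L2_norm_nonneg[of \<tau> "window n"] by (intro mult_left_mono mult_right_mono; simp)+
  ultimately have bM: "\<bar>k\<bar> * (M * (C1 * L2_norm \<tau> (window n))) \<le> b n"
    and b1: "\<bar>k\<bar> * (C1 * L2_norm \<tau> (window n)) \<le> b n" for n
    by simp_all
  have a_Suc: "a (Suc n) \<le> q * a n + b n" for n
    using orbit_norm_U_Suc[of n] bM[of n] unfolding a_def q by linarith
  have b_Suc: "b (Suc n) \<le> \<kappa> * (a n + b n)" for n
  proof -
    let ?L = "L2_norm \<tau> (window n)"
    have "L2_norm \<tau> (window (Suc n)) \<le> C2 * norm (U (real n * \<tau>)) + \<bar>k\<bar> * (C3 * ?L)"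
      by (rule window_Suc(2)[OF window_L2])
    also have "\<dots> \<le> C4 * a n + \<bar>k\<bar> * ((M' * C1 * C4) * ?L)"
      unfolding a_def using C2 C4
      by (intro add_mono mult_mono mult_left_mono mult_right_mono norm_le_orbit_norm L2_norm_nonneg) auto
    also have "\<dots> = C4 * (a n + b n)" by (simp add: b_def algebra_simps)
    finally have "b (Suc n) \<le> (\<bar>k\<bar> * M' * C1) * (C4 * (a n + b n))"
      unfolding b_def[of "Suc n"] by (rule mult_left_mono[OF _ g])
    then show ?thesis by (simp add: \<kappa> mult.assoc)
  qed
  have step: "a (Suc n) + b (Suc n) / q \<le> (q + \<kappa> / q) * (a n + b n / q)" for n
  proof -
    have "a (Suc n) + b (Suc n) / q \<le> (q * a n + b n) + \<kappa> * (a n + b n) / q"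
      using q01 by (intro add_mono a_Suc divide_right_mono b_Suc) auto
    also have "\<dots> = (q + \<kappa> / q) * a n + b n + \<kappa> * b n / q"
      by (simp add: algebra_simps add_divide_distrib)
    \<comment> \<open>the slack that makes the two coefficients proportional to the weights\<close>
    also have "\<kappa> * b n / q \<le> \<kappa> * b n / q / q"
      using q01 \<kappa>0 b0[of n] by (intro pos_le_divide_eq[THEN iffD2] mult_left_le) auto
    also have "(q + \<kappa> / q) * a n + b n + \<kappa> * b n / q / q = (q + \<kappa> / q) * (a n + b n / q)"
      using q01 by (simp add: algebra_simps)
    finally show ?thesis by simp
  qed
  have \<rho>: "q + \<kappa> / q \<ge> 0" using q01 \<kappa>0 by simp
  have iter: "a n + b n / q \<le> (q + \<kappa> / q) ^ n * (a 0 + b 0 / q)" for n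
  proof (induction n)
    case (Suc n)
    have "a (Suc n) + b (Suc n) / q \<le> (q + \<kappa> / q) * (a n + b n / q)" by (rule step)
    also have "\<dots> \<le> (q + \<kappa> / q) * ((q + \<kappa> / q) ^ n * (a 0 + b 0 / q))"
      by (rule mult_left_mono[OF Suc.IH \<rho>])
    finally show ?case by (simp add: mult.assoc)
  qed simp
  have "norm (U (real n * \<tau> + s)) \<le> a n + b n"
    using norm_U_le[OF s, of n] b1[of n] unfolding a_def by linarith
  also have "\<dots> \<le> a n + b n / q"
    using q01 b0[of n] by (simp add: pos_le_divide_eq mult_left_le)
  also note iter[of n]
  also have "(q + \<kappa> / q) ^ n * (a 0 + b 0 / q)
      \<le> (q + \<kappa> / q) ^ n * (M' * norm U0 + \<bar>k\<bar> * M' * C1 * L2_norm \<tau> f / q)"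
  proof (rule mult_left_mono)
    have "a 0 \<le> M * norm U0" using orbit_norm_le[of U0] by (simp add: a_def U_0)
    also have "\<dots> \<le> M' * norm U0" using M' by (intro mult_right_mono) auto
    finally show "a 0 + b 0 / q \<le> M' * norm U0 + \<bar>k\<bar> * M' * C1 * L2_norm \<tau> f / q"
      by (simp add: b_def window_0)
  qed (use \<rho> in simp)
  finally show ?thesis .
qed

end

section \<open>Exponential stability\<close>

text \<open>The rate is \<open>- ln \<rho> / \<tau>\<close>; replacing the continuous time by the number of completed
  intervals costs at most one factor \<open>\<rho>\<close>.\<close>

lemma geometric_le_exponential:
  assumes \<rho>: "0 < \<rho>" "\<rho> < 1" and \<tau>: "\<tau> > 0" and t: "t \<le> (real n + 1) * \<tau>"
  shows "\<rho> ^ n \<le> (1 / \<rho>) * exp (- (- ln \<rho> / \<tau>) * t)"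
proof -
  have "t / \<tau> \<le> real n + 1" using t \<tau> by (simp add: pos_divide_le_eq)
  then have "(real n + 1) * ln \<rho> \<le> (t / \<tau>) * ln \<rho>"
    using \<rho> by (intro mult_right_mono_neg) auto
  then have "real n * ln \<rho> \<le> - ln \<rho> + (- (- ln \<rho> / \<tau>) * t)"
    by (simp add: algebra_simps)
  then have "exp (real n * ln \<rho>) \<le> exp (- ln \<rho>) * exp (- (- ln \<rho> / \<tau>) * t)"
    by (simp only: exp_le_cancel_iff flip: exp_add)
  moreover have "exp (real n * ln \<rho>) = \<rho> ^ n" "exp (- ln \<rho>) = 1 / \<rho>"
    using \<rho> by (simp_all add: exp_of_nat_mult exp_minus inverse_eq_divide)
  ultimately show ?thesis by simp
qed

theorem theorem4p2:
  fixes DA :: "'h::complex_hilbert set" and A :: "'h \<Rightarrow> 'h" and S :: "real \<Rightarrow> 'h \<Rightarrow> 'h"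
    and pair :: "'e::complex_banach \<Rightarrow> 'h \<Rightarrow> complex" and emb :: "'h \<Rightarrow> 'e"
    and Se :: "real \<Rightarrow> 'e \<Rightarrow> 'e"
    and C :: "'u::complex_hilbert \<Rightarrow> 'e" and DC :: "'h set" and Cs :: "'h \<Rightarrow> 'u"
    and M \<omega> \<tau> C1 C2 C3 M' C4 k0 :: real
  assumes "generates DA A S"
    and "M > 0" and "\<omega> > 0" and "\<tau> > 0"
    and "\<forall>t\<ge>0. onorm (S t) \<le> M * exp (- \<omega> * t)"
    and "is_H_minus_1 DA A pair emb"
    and "C0_semigroup Se" and "\<forall>t\<ge>0. \<forall>x. Se t (emb x) = emb (S t x)"
    and "control_pair DA A pair C DC Cs"
    and "hyp_H1 emb Se C \<tau> C1"
    and "hyp_H2 emb Se C DC Cs \<tau> C3"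
    and "hyp_H3 S DC Cs \<tau> C2"
    and "M' = max M 1"
    and "C4 = max C2 (C3 / (M' * C1))"
    and "k0 = (exp (\<tau> * \<omega>) - 1) / (M'\<^sup>2 * C1 * C4 * exp (2 * \<omega> * \<tau>))"
  shows "\<forall>k::real. \<bar>k\<bar> < k0 \<longrightarrow>
    (\<exists>\<omega>'>0. \<exists>M''>0. \<forall>U0. \<forall>f \<in> L2 \<tau>. \<forall>U. mild_solution emb S Se C DC Cs \<tau> k U0 f U \<longrightarrow>
       (\<forall>t>0. norm (U t) \<le> M'' * exp (- \<omega>' * t) *
          (norm U0 + \<bar>k\<bar> * M' * C1 * exp (2 * \<omega> * \<tau>) * L2_norm \<tau> f)))"
proof (intro allI impI)
  fix k :: real assume k: "\<bar>k\<bar> < k0"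
  have M'1: "M' \<ge> 1" and M'M: "M' \<ge> M" using assms(13) by auto
  have C1: "C1 > 0" using assms(10) by (simp add: hyp_H1_def)
  have C2: "C2 > 0" using assms(12) by (simp add: hyp_H3_def)
  have C42: "C4 \<ge> C2" and "C3 / (M' * C1) \<le> C4" using assms(14) by auto
  then have C43: "C3 \<le> M' * C1 * C4" using M'1 C1 by (simp add: pos_divide_le_eq mult.commute)
  define q where "q = exp (- \<omega> * \<tau>)"
  have q: "0 < q" "q < 1" using assms(3,4) by (auto simp: q_def)
  define \<kappa> where "\<kappa> = \<bar>k\<bar> * M' * C1 * C4"
  have \<kappa>0: "\<kappa> \<ge> 0" using M'1 C1 C2 C42 by (simp add: \<kappa>_def)
  have \<kappa>: "\<kappa> < q * (1 - q)"
  proof -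
    have e: "exp (\<tau> * \<omega>) = 1 / q" "exp (2 * \<omega> * \<tau>) = 1 / q\<^sup>2"
      by (simp_all add: q_def exp_minus inverse_eq_divide mult.commute power2_eq_square flip: exp_add)
    have P: "M'\<^sup>2 * C1 * C4 > 0" using M'1 C1 C2 C42 by simp
    have "k0 = (1 / q - 1) / (M'\<^sup>2 * C1 * C4 * (1 / q\<^sup>2))"
      unfolding assms(15) e ..
    also have "\<dots> = q * (1 - q) / (M'\<^sup>2 * C1 * C4)"
      using q by (simp add: divide_simps) (simp add: power2_eq_square algebra_simps)
    finally have "\<bar>k\<bar> * (M'\<^sup>2 * C1 * C4) < q * (1 - q)"
      using k P by (simp add: pos_less_divide_eq)
    \<comment> \<open>the threshold bounds \<open>\<kappa> * M'\<close>, which is at least \<open>\<kappa>\<close> since \<open>M' \<ge> 1\<close>\<close>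
    moreover have "\<kappa> * 1 \<le> \<kappa> * M'" by (rule mult_left_mono[OF M'1 \<kappa>0])
    moreover have "\<kappa> * M' = \<bar>k\<bar> * (M'\<^sup>2 * C1 * C4)" by (simp add: \<kappa>_def power2_eq_square)
    ultimately show ?thesis by simp
  qed
  define \<rho> where "\<rho> = q + \<kappa> / q"
  have \<rho>: "0 < \<rho>" "\<rho> < 1"
  proof -
    show "0 < \<rho>" using q \<kappa>0 by (simp add: \<rho>_def add_pos_nonneg)
    have "\<kappa> / q < 1 - q" using \<kappa> q by (simp add: pos_divide_less_eq mult.commute)
    then show "\<rho> < 1" by (simp add: \<rho>_def)
  qed
  define \<omega>' where "\<omega>' = - ln \<rho> / \<tau>"
  have "\<omega>' > 0" using ln_less_zero[OF \<rho>] assms(4) by (simp add: \<omega>'_def divide_neg_pos)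
  moreover have "M' / \<rho> > 0" using \<rho> M'1 by simp
  moreover have "norm (U t) \<le> M' / \<rho> * exp (- \<omega>' * t) *
      (norm U0 + \<bar>k\<bar> * M' * C1 * exp (2 * \<omega> * \<tau>) * L2_norm \<tau> f)"
    if f: "f \<in> L2 \<tau>" and U: "mild_solution emb S Se C DC Cs \<tau> k U0 f U" and t: "t > 0"
    for U0 :: 'h and f U t
  proof -
    have decay: "norm (S t x) \<le> M * exp (- \<omega> * t) * norm x" if "t \<ge> 0" for t x
    proof -
      have "bounded_linear (S t)"
        using assms(1) that by (auto simp: generates_def C0_semigroup_def bounded_clinear_def)
      from onorm[OF this, of x] show ?thesis
        using assms(5) that by (meson mult_right_mono norm_ge_zero order_trans)
    qed
    have bound: "norm (S t x) \<le> M * norm x" if "t \<ge> 0" for t x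
    proof -
      have "M * exp (- \<omega> * t) * norm x \<le> M * 1 * norm x"
        using assms(2,3) that by (intro mult_right_mono mult_left_mono) auto
      then show ?thesis using decay[OF that, of x] by simp
    qed
    interpret delay_solution DA A S M pair emb \<omega> Se C DC Cs \<tau> C1 C2 C3 k U0 f U
      by unfold_locales (use assms f U decay bound in auto)
    define n where "n = nat \<lfloor>t / \<tau>\<rfloor>"
    have fl: "real n \<le> t / \<tau>" "t / \<tau> \<le> real n + 1"
      using t assms(4) by (auto simp: n_def)
    then have nt: "real n * \<tau> \<le> t" "t \<le> (real n + 1) * \<tau>"
      using assms(4) by (simp_all add: pos_le_divide_eq pos_divide_le_eq)
    then have s: "t - real n * \<tau> \<in> {0..\<tau>}" by (auto simp: algebra_simps)
    let ?X = "norm U0 + \<bar>k\<bar> * M' * C1 * exp (2 * \<omega> * \<tau>) * L2_norm \<tau> f"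
    have g: "\<bar>k\<bar> * M' * C1 \<ge> 0" using M'1 C1 by simp
    have "norm (U t) \<le> \<rho> ^ n * (M' * norm U0 + \<bar>k\<bar> * M' * C1 * L2_norm \<tau> f / q)"
      using norm_U_geometric[OF M'1 M'M C42 C43 q_def \<kappa>_def s, of n] by (simp add: \<rho>_def)
    also have "\<dots> \<le> \<rho> ^ n * (M' * ?X)"
    proof (rule mult_left_mono)
      have e: "exp (2 * \<omega> * \<tau>) = 1 / q\<^sup>2"
        by (simp add: q_def exp_minus inverse_eq_divide mult.commute power2_eq_square flip: exp_add)
      have "1 / q \<le> 1 / q\<^sup>2"
        using q by (intro divide_left_mono) (auto simp: power2_eq_square mult_le_cancel_left1)
      also have "\<dots> \<le> M' * (1 / q\<^sup>2)" using M'1 mult_right_mono[OF M'1, of "1 / q\<^sup>2"] by simp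
      finally have "(\<bar>k\<bar> * M' * C1 * L2_norm \<tau> f) * (1 / q) \<le> (\<bar>k\<bar> * M' * C1 * L2_norm \<tau> f) * (M' * (1 / q\<^sup>2))"
        by (rule mult_left_mono) (rule mult_nonneg_nonneg[OF g L2_norm_nonneg])
      then show "M' * norm U0 + \<bar>k\<bar> * M' * C1 * L2_norm \<tau> f / q \<le> M' * ?X"
        unfolding e by (simp add: algebra_simps)
    qed (use \<rho> in simp)
    also have "\<dots> \<le> ((1 / \<rho>) * exp (- \<omega>' * t)) * (M' * ?X)"
    proof (rule mult_right_mono)
      show "\<rho> ^ n \<le> (1 / \<rho>) * exp (- \<omega>' * t)"
        unfolding \<omega>'_def by (rule geometric_le_exponential[OF \<rho> assms(4) nt(2)])
      show "0 \<le> M' * ?X"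
        using M'1 mult_nonneg_nonneg[OF g, of "exp (2 * \<omega> * \<tau>) * L2_norm \<tau> f"]
        by (simp add: L2_norm_nonneg mult.assoc)
    qed
    also have "\<dots> = M' / \<rho> * exp (- \<omega>' * t) * ?X" by simp
    finally show ?thesis .
  qed
  ultimately show "\<exists>\<omega>'>0. \<exists>M''>0. \<forall>U0. \<forall>f \<in> L2 \<tau>. \<forall>U. mild_solution emb S Se C DC Cs \<tau> k U0 f U \<longrightarrow>
       (\<forall>t>0. norm (U t) \<le> M'' * exp (- \<omega>' * t) *
          (norm U0 + \<bar>k\<bar> * M' * C1 * exp (2 * \<omega> * \<tau>) * L2_norm \<tau> f))"
    by (intro exI[of _ \<omega>'] conjI exI[of _ "M' / \<rho>"]) auto
qed

end
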